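(* For every $\psi\in \mathbb{L}^{\ge 3}(x,y)$, the following two conditions are equivalent: (1) $S_*(\psi_* )=-\psi_*$; (2) $[\psi(x,y),x]+[\psi(-x-y,y),-x-y]=0$.
   Context: $\mathbb{K}$ is a field of characteristic $0$. $A=\mathbb{K}\langle\langle x,y\rangle\rangle$ is the algebra of noncommutative formal power series with concatenation product, graded by $\deg x=\deg y=1$; $\varepsilon:A\to\mathbb{K}$ is the constant term. $\mathbb{L}(x,y)\subset A$ is the degree-completed free Lie algebra on $x,y$ (Lie series, with commutator bracket), and $\mathbb{L}^{\ge n}(x,y)$ is the subspace of Lie series with no terms of degree less than $n$. For $P\in A$ and $s,t\in A$ with zero constant term, $P(s,t)$ is the image of $P$ under the continuous algebra morphism $x\mapsto s$, $y\mapsto t$. $(P\mid w)$ is the coefficient of the word $w$ in $P$. Every $P\in A$ is uniquely written $P=\varepsilon(P)+P_xx+P_yy$ with $P_x,P_y\in A$. Harmonic Hopf algebra: $\mathbb{K}\langle Y\rangle$ is the free associative algebra on generators $Y_i$ ($i\ge1$, $\deg Y_i=i$), with concatenation product, counit $Y_i\mapsto 0$, and coproduct the algebra morphism with $\Delta_*(Y_m)=Y_m\otimes 1+1\otimes Y_m-\sum_{r+s=m,\,r,s\ge1}Y_r\otimes Y_s$. It is a connected graded bialgebra, hence a Hopf algebra; $S_*$ is its antipode (harmonic antipode), extended continuously to the degree completion $\mathbb{K}\langle\langle Y\rangle\rangle$. The map $Y_m\mapsto x^{m-1}y$ identifies $\mathbb{K}\langle\langle Y\rangle\rangle$ with the subalgebra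 $\mathbb{K}\oplus Ay$ of $A$. Let $\pi_Y:A\to\mathbb{K}\oplus Ay$, $\pi_Y(P)=\varepsilon(P)+P_yy$. The regularization of $\alpha\in A$ is $\alpha_*:=\pi_Y(\alpha)+\sum_{n\ge1}\frac{(\alpha\mid x^{n-1}y)}{n}y^n\in\mathbb{K}\langle\langle Y\rangle\rangle$ (so $y=Y_1$). *)

theory Defs
  imports Complex_Main "HOL-Library.Poly_Mapping" "HOL-Library.Product_Plus"
begin

section \<open>Words\<close>

text \<open>
  Lists under concatenation are an (additively written) monoid. With this instance
  \<open>'a list \<Rightarrow>\<^sub>0 'k\<close> is the free associative algebra on the letters \<open>'a\<close>, and
  \<open>('a list \<times> 'a list) \<Rightarrow>\<^sub>0 'k\<close> is its tensor square, both with the library's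
  convolution product.
\<close>

instantiation list :: (type) monoid_add
begin
definition zero_list :: "'a list" where "zero_list = []"
definition plus_list :: "'a list \<Rightarrow> 'a list \<Rightarrow> 'a list" where "plus_list u v = u @ v"
instance by standard (simp_all add: zero_list_def plus_list_def)
end


section \<open>Noncommutative formal power series\<close>

typedef ('a, 'k) ncps = "UNIV :: ('a list \<Rightarrow> 'k) set"
  morphisms coeff NCPS
  by simp

lemma coeff_NCPS [simp]: "coeff (NCPS f) = f"
  by (simp add: NCPS_inverse)

lemma ncps_eqI: "(\<And>w. coeff P w = coeff Q w) \<Longrightarrow> P = Q"
  by (simp add: coeff_inject [symmetric] fun_eq_iff)

instantiation ncps :: (type, ring_1) ring_1
begin
definition zero_ncps :: "('a, 'b) ncps" where "zero_ncps = NCPS (\<lambda>w. 0)"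
definition one_ncps :: "('a, 'b) ncps" where "one_ncps = NCPS (\<lambda>w. if w = [] then 1 else 0)"
definition plus_ncps :: "('a, 'b) ncps \<Rightarrow> ('a, 'b) ncps \<Rightarrow> ('a, 'b) ncps"
  where "plus_ncps P Q = NCPS (\<lambda>w. coeff P w + coeff Q w)"
definition minus_ncps :: "('a, 'b) ncps \<Rightarrow> ('a, 'b) ncps \<Rightarrow> ('a, 'b) ncps"
  where "minus_ncps P Q = NCPS (\<lambda>w. coeff P w - coeff Q w)"
definition uminus_ncps :: "('a, 'b) ncps \<Rightarrow> ('a, 'b) ncps"
  where "uminus_ncps P = NCPS (\<lambda>w. - coeff P w)"
definition times_ncps :: "('a, 'b) ncps \<Rightarrow> ('a, 'b) ncps \<Rightarrow> ('a, 'b) ncps"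
  where "times_ncps P Q = NCPS (\<lambda>w. \<Sum>i\<le>length w. coeff P (take i w) * coeff Q (drop i w))"
instance
proof
  fix P Q R :: "('a, 'b) ncps"
  show "P * Q * R = P * (Q * R)"
  proof (rule ncps_eqI)
    fix w
    let ?f = "\<lambda>j i. coeff P (take j w) * (coeff Q (drop j (take (j + i) w)) * coeff R (drop (j + i) w))"
    let ?n = "length w"
    have "coeff (P * Q * R) w = (\<Sum>i\<le>?n. \<Sum>j\<le>i. ?f j (i - j))"
      by (auto simp: times_ncps_def sum_distrib_right mult.assoc min_def intro!: sum.cong)
    also have "\<dots> = (\<Sum>(i, j)\<in>Sigma {..?n} (\<lambda>i. {..i}). ?f j (i - j))"
      by (rule sum.Sigma) auto
    also have "\<dots> = (\<Sum>(j, i)\<in>Sigma {..?n} (\<lambda>j. {..?n - j}). ?f j i)"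
      by (rule sum.reindex_bij_witness
          [where i = "\<lambda>(j, i). (j + i, j)" and j = "\<lambda>(i, j). (j, i - j)"]) auto
    also have "\<dots> = (\<Sum>j\<le>?n. \<Sum>i\<le>?n - j. ?f j i)"
      by (rule sum.Sigma [symmetric]) auto
    also have "\<dots> = coeff (P * (Q * R)) w"
      by (auto simp: times_ncps_def sum_distrib_left take_drop add.commute intro!: sum.cong)
    finally show "coeff (P * Q * R) w = coeff (P * (Q * R)) w" .
  qed
  show "1 * P = P"
  proof (rule ncps_eqI)
    fix w
    have "coeff (1 * P) w = (\<Sum>i\<in>{0}. coeff P (drop i w))"
      unfolding times_ncps_def one_ncps_def coeff_NCPS
      by (rule sum.mono_neutral_cong_right) auto
    then show "coeff (1 * P) w = coeff P w" by simp
  qed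
  show "P * 1 = P"
  proof (rule ncps_eqI)
    fix w
    have "coeff (P * 1) w = (\<Sum>i\<in>{length w}. coeff P (take i w))"
      unfolding times_ncps_def one_ncps_def coeff_NCPS
      by (rule sum.mono_neutral_cong_right) auto
    then show "coeff (P * 1) w = coeff P w" by simp
  qed
  show "(0 :: ('a, 'b) ncps) \<noteq> 1"
  proof
    assume "(0 :: ('a, 'b) ncps) = 1"
    then have "coeff (0 :: ('a, 'b) ncps) [] = coeff 1 []" by simp
    then show False by (simp add: zero_ncps_def one_ncps_def)
  qed
qed (rule ncps_eqI, simp add: plus_ncps_def minus_ncps_def uminus_ncps_def zero_ncps_def
      times_ncps_def algebra_simps sum.distrib)+
end

definition scale :: "'k \<Rightarrow> ('a, 'k) ncps \<Rightarrow> ('a, 'k::ring_1) ncps"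
  where "scale c P = NCPS (\<lambda>w. c * coeff P w)"

definition gen :: "'a \<Rightarrow> ('a, 'k::ring_1) ncps"
  where "gen a = NCPS (\<lambda>w. if w = [a] then 1 else 0)"

definition commutator :: "'r::ring \<Rightarrow> 'r \<Rightarrow> 'r"
  where "commutator a b = a * b - b * a"

definition homogeneous_part :: "nat \<Rightarrow> ('a, 'k) ncps \<Rightarrow> ('a, 'k::ring_1) ncps"
  where "homogeneous_part n P = NCPS (\<lambda>w. if length w = n then coeff P w else 0)"


section \<open>The algebra of series in x and y, and Lie series\<close>

datatype letter = X | Y

type_synonym 'k series = "(letter, 'k) ncps"

inductive_set lie_polynomials :: "('k::ring_1) series set" where
  gen: "gen a \<in> lie_polynomials"
| zero: "0 \<in> lie_polynomials"
| add: "P \<in> lie_polynomials \<Longrightarrow> Q \<in> lie_polynomials \<Longrightarrow> P + Q \<in> lie_polynomials"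
| scale: "P \<in> lie_polynomials \<Longrightarrow> scale c P \<in> lie_polynomials"
| bracket: "P \<in> lie_polynomials \<Longrightarrow> Q \<in> lie_polynomials \<Longrightarrow> commutator P Q \<in> lie_polynomials"

definition lie_series :: "('k::ring_1) series set"
  where "lie_series = {P. \<forall>n. homogeneous_part n P \<in> lie_polynomials}"

definition lie_series_ge :: "nat \<Rightarrow> ('k::ring_1) series set"
  where "lie_series_ge n = {P \<in> lie_series. \<forall>w. length w < n \<longrightarrow> coeff P w = 0}"

text \<open>
  \<open>subst P s t\<close> is \<open>P(s,t)\<close>, meant for \<open>s\<close>, \<open>t\<close> with zero constant term: then the value of a
  word \<open>v\<close> has no terms of degree less than \<open>length v\<close>, so the coefficient at \<open>w\<close> of the
  infinite sum over all words \<open>v\<close> only involves those with \<open>length v \<le> length w\<close>.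
\<close>

fun letter_val :: "'r \<Rightarrow> 'r \<Rightarrow> letter \<Rightarrow> 'r" where
  "letter_val s t X = s"
| "letter_val s t Y = t"

definition subst :: "'k series \<Rightarrow> 'k series \<Rightarrow> 'k series \<Rightarrow> ('k::ring_1) series"
  where "subst P s t = NCPS (\<lambda>w. \<Sum>v | length v \<le> length w.
           coeff P v * coeff (prod_list (map (letter_val s t) v)) w)"


section \<open>The harmonic Hopf algebra\<close>

text \<open>
  The letter \<open>Y\<^sub>m\<close> (\<open>m \<ge> 1\<close>) of the alphabet of the harmonic algebra is encoded as the natural
  number \<open>m - 1\<close>, so that the words in the \<open>Y\<^sub>m\<close> are exactly the lists of natural numbers.
\<close>

type_synonym yword = "nat list"
type_synonym 'k ypoly = "yword \<Rightarrow>\<^sub>0 'k"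
type_synonym 'k ytensor = "(yword \<times> yword) \<Rightarrow>\<^sub>0 'k"
type_synonym 'k yseries = "(nat, 'k) ncps"

abbreviation YL :: "nat \<Rightarrow> yword" where "YL m \<equiv> [m - 1]"

definition weight :: "yword \<Rightarrow> nat" where "weight u = sum_list (map Suc u)"

abbreviation const :: "'k \<Rightarrow> ('m::monoid_add \<Rightarrow>\<^sub>0 'k::ring_1)"
  where "const c \<equiv> Poly_Mapping.single 0 c"

abbreviation monomial :: "'m \<Rightarrow> ('m \<Rightarrow>\<^sub>0 'k::ring_1)"
  where "monomial u \<equiv> Poly_Mapping.single u 1"

definition lin_ext :: "('m \<Rightarrow> ('n::monoid_add \<Rightarrow>\<^sub>0 'k)) \<Rightarrow> ('m \<Rightarrow>\<^sub>0 'k) \<Rightarrow> ('n \<Rightarrow>\<^sub>0 'k::ring_1)"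
  where "lin_ext F p = (\<Sum>u\<in>Poly_Mapping.keys p. const (Poly_Mapping.lookup p u) * F u)"

definition is_linear :: "(('m::monoid_add \<Rightarrow>\<^sub>0 'k) \<Rightarrow> ('n::monoid_add \<Rightarrow>\<^sub>0 'k::ring_1)) \<Rightarrow> bool"
  where "is_linear f \<longleftrightarrow>
    (\<forall>p q. f (p + q) = f p + f q) \<and> (\<forall>c p. f (const c * p) = const c * f p)"

text \<open>\<open>\<Delta>\<^sub>*(Y\<^sub>m)\<close>; the monomial at \<open>(u, v)\<close> is \<open>u \<otimes> v\<close>.\<close>

definition harmonic_coproduct_gen :: "nat \<Rightarrow> ('k::ring_1) ytensor"
  where "harmonic_coproduct_gen m = monomial (YL m, []) + monomial ([], YL m)
           - (\<Sum>(r, s) | r \<ge> 1 \<and> s \<ge> 1 \<and> r + s = m. monomial (YL r, YL s))"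

definition harmonic_coproduct_word :: "yword \<Rightarrow> ('k::ring_1) ytensor"
  where "harmonic_coproduct_word u = prod_list (map (\<lambda>k. harmonic_coproduct_gen (Suc k)) u)"

definition harmonic_coproduct :: "'k ypoly \<Rightarrow> ('k::ring_1) ytensor"
  where "harmonic_coproduct = lin_ext harmonic_coproduct_word"

definition harmonic_counit :: "('k::ring_1) ypoly \<Rightarrow> 'k"
  where "harmonic_counit p = Poly_Mapping.lookup p []"

text \<open>For linear \<open>f\<close> and \<open>g\<close>: the composite of coproduct, \<open>f \<otimes> g\<close> and multiplication.\<close>

definition convolve :: "('k ypoly \<Rightarrow> 'k ypoly) \<Rightarrow> ('k ypoly \<Rightarrow> 'k ypoly) \<Rightarrow> 'k ypoly \<Rightarrow> ('k::ring_1) ypoly"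
  where "convolve f g p =
    lin_ext (\<lambda>(u, v). f (monomial u) * g (monomial v)) (harmonic_coproduct p)"

definition is_harmonic_antipode :: "('k ypoly \<Rightarrow> ('k::ring_1) ypoly) \<Rightarrow> bool"
  where "is_harmonic_antipode S \<longleftrightarrow> is_linear S \<and>
    (\<forall>p. convolve S (\<lambda>q. q) p = const (harmonic_counit p)) \<and>
    (\<forall>p. convolve (\<lambda>q. q) S p = const (harmonic_counit p))"

text \<open>Existence and uniqueness are established below (\<open>harmonic_antipode_unique_exists\<close>).\<close>

definition harmonic_antipode_poly :: "'k ypoly \<Rightarrow> ('k::ring_1) ypoly"
  where "harmonic_antipode_poly = (THE S. is_harmonic_antipode S)"

text \<open>
  The continuous extension to series. The antipode preserves weight
  (\<open>harmonic_antipode_weight\<close>) and there are finitely many words of a given weight, so the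
  coefficient at \<open>w\<close> of the image of a series only depends on its part of weight \<open>weight w\<close>.
\<close>

definition harmonic_antipode :: "'k yseries \<Rightarrow> ('k::ring_1) yseries"
  where "harmonic_antipode P = NCPS (\<lambda>w. \<Sum>v | weight v = weight w.
           coeff P v * Poly_Mapping.lookup (harmonic_antipode_poly (monomial v)) w)"


section \<open>Regularization\<close>

definition const_term :: "('k::ring_1) series \<Rightarrow> 'k"
  where "const_term P = coeff P []"

definition right_factor :: "letter \<Rightarrow> 'k series \<Rightarrow> ('k::ring_1) series"
  where "right_factor a P = NCPS (\<lambda>w. coeff P (w @ [a]))"

definition pi_Y :: "'k series \<Rightarrow> ('k::ring_1) series"
  where "pi_Y P = scale (const_term P) 1 + right_factor Y P * gen Y"

text \<open>
  The word in \<open>x\<close>, \<open>y\<close> that a word in the \<open>Y\<^sub>m\<close> stands for (\<open>Y\<^sub>m \<mapsto> x\<^sup>m\<^sup>-\<^sup>1 y\<close>), and the inverse of the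
  induced identification of \<open>\<bbbK>\<langle>\<langle>Y\<rangle>\<rangle>\<close> with \<open>\<bbbK> \<oplus> A y\<close>; the latter is applied to members
  of \<open>\<bbbK> \<oplus> A y\<close> only.
\<close>

definition word_of_yword :: "yword \<Rightarrow> letter list"
  where "word_of_yword u = concat (map (\<lambda>k. replicate k X @ [Y]) u)"

definition to_yseries :: "'k series \<Rightarrow> ('k::ring_1) yseries"
  where "to_yseries P = NCPS (\<lambda>u. coeff P (word_of_yword u))"

text \<open>The series \<open>\<Sum>\<^sub>n\<^sub>\<ge>\<^sub>1 (\<alpha> | x\<^sup>n\<^sup>-\<^sup>1 y) / n y\<^sup>n\<close>.\<close>

definition regularization_correction :: "'k series \<Rightarrow> ('k::field_char_0) series"
  where "regularization_correction \<alpha> = NCPS (\<lambda>w. let n = length w in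
           if n \<ge> 1 \<and> w = replicate n Y
           then coeff \<alpha> (replicate (n - 1) X @ [Y]) / of_nat n else 0)"

definition regularization :: "'k series \<Rightarrow> ('k::field_char_0) yseries"
  where "regularization \<alpha> = to_yseries (pi_Y \<alpha> + regularization_correction \<alpha>)"


section \<open>The harmonic antipode is well defined\<close>

lemma lin_ext_superset:
  assumes "finite A" "Poly_Mapping.keys p \<subseteq> A"
  shows "lin_ext F p = (\<Sum>u\<in>A. const (Poly_Mapping.lookup p u) * F u)"
  unfolding lin_ext_def using assms
  by (intro sum.mono_neutral_left) (auto simp: in_keys_iff)

lemma lin_ext_add: "lin_ext F (p + q) = lin_ext F p + lin_ext F q"
proof -
  let ?A = "Poly_Mapping.keys p \<union> Poly_Mapping.keys q"
  have "lin_ext F r = (\<Sum>u\<in>?A. const (Poly_Mapping.lookup r u) * F u)"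
    if "r \<in> {p, q, p + q}" for r
    using that keys_add [of p q] by (intro lin_ext_superset) auto
  then show ?thesis
    by (simp add: lookup_add single_add distrib_right sum.distrib)
qed

lemma lin_ext_zero [simp]: "lin_ext F 0 = 0"
  by (simp add: lin_ext_def)

lemma lin_ext_zero_fun [simp]: "lin_ext (\<lambda>(u, v). 0) p = 0"
  by (simp add: lin_ext_def case_prod_beta)

lemma lin_ext_single: "lin_ext F (Poly_Mapping.single u c) = const c * F u"
  by (cases "c = 0") (simp_all add: lin_ext_def)

lemma poly_induct [case_names single add]:
  assumes "\<And>u c. P (Poly_Mapping.single u c)"
    and "\<And>p q. P p \<Longrightarrow> P q \<Longrightarrow> P (p + q)"
  shows "P (p :: 'm \<Rightarrow>\<^sub>0 'k::ring_1)"
proof (induction p rule: update_induct)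
  case const
  show ?case using assms(1) [of undefined 0] by simp
next
  case (update f a b)
  have "Poly_Mapping.update a b f = f + Poly_Mapping.single a b"
    using update
    by (intro poly_mapping_eqI) (auto simp: lookup_update lookup_add lookup_single in_keys_iff when_def)
  then show ?case using assms update by simp
qed

lemma const_commute: "const c * p = p * const (c :: 'k::comm_ring_1)"
  by (induction p rule: poly_induct) (simp_all add: mult_single mult.commute distrib_left distrib_right)

lemma const_mult: "const (c * d) = const c * (const d :: 'm::monoid_add \<Rightarrow>\<^sub>0 'k::ring_1)"
  by (simp add: mult_single)

lemma lin_ext_const: "lin_ext F (const (c :: 'k::ring_1) * p) = const c * lin_ext F p"
  by (induction p rule: poly_induct)
    (simp_all add: mult_single lin_ext_single lin_ext_add distrib_left mult.assoc [symmetric])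

lemma linear_lin_ext: "is_linear (lin_ext F)"
  by (simp add: is_linear_def lin_ext_add lin_ext_const)

lemma linear_eqI:
  assumes "is_linear f" "is_linear g" "\<And>u. f (monomial u) = g (monomial u)"
  shows "f = g"
proof
  fix p
  show "f p = g p"
  proof (induction p rule: poly_induct)
    case (single u c)
    have "f (const c * monomial u) = g (const c * monomial u)"
      using assms unfolding is_linear_def by metis
    then show ?case by (simp add: mult_single)
  next
    case (add p q)
    then show ?case using assms by (simp add: is_linear_def)
  qed
qed

lemma lin_ext_const_diff: "lin_ext F (p - q) = lin_ext F p - lin_ext F q"
  using lin_ext_add [of F "p - q" q] by simp

lemma lin_ext_sum: "lin_ext F (\<Sum>i\<in>A. f i) = (\<Sum>i\<in>A. lin_ext F (f i))"
  by (induction A rule: infinite_finite_induct) (simp_all add: lin_ext_add)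

lemma YL_sum_shift:
  "(\<Sum>(r, s) | r \<ge> 1 \<and> s \<ge> 1 \<and> r + s = Suc k. f (YL r) (YL s)) = (\<Sum>i<k. f [i] [k - Suc i])"
  by (rule sum.reindex_bij_witness [where i = "\<lambda>i. (Suc i, k - i)" and j = "\<lambda>(r, s). r - 1"])
    (auto simp: Suc_le_eq dest!: gr0_implies_Suc)

lemma harmonic_coproduct_gen_Suc:
  "harmonic_coproduct_gen (Suc k) = monomial ([k], []) + monomial ([], [k])
     - (\<Sum>i<k. monomial ([i], [k - Suc i]))"
  using YL_sum_shift [where f = "\<lambda>u v. monomial (u, v)"]
  by (simp add: harmonic_coproduct_gen_def)

text \<open>The antipode on generators, from \<open>\<Sum>\<^sub>m Y\<^sub>m t\<^sup>m\<close> being one minus a grouplike series.\<close>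

fun antipode_letter :: "nat \<Rightarrow> ('k::ring_1) ypoly" where
  "antipode_letter k = - monomial [k] + (\<Sum>i<k. if i < k then antipode_letter i * monomial [k - Suc i] else 0)"

declare antipode_letter.simps [simp del]

lemma antipode_letter_left:
  "antipode_letter k = - monomial [k] + (\<Sum>i<k. antipode_letter i * monomial [k - Suc i])"
  by (subst antipode_letter.simps) simp

lemma sum_triangle:
  fixes g :: "nat \<Rightarrow> nat \<Rightarrow> nat \<Rightarrow> 'm::comm_monoid_add"
  shows "(\<Sum>i<k. \<Sum>j<i. g j (i - Suc j) (k - Suc i)) =
    (\<Sum>j<k. \<Sum>i<k - Suc j. g j i (k - Suc j - Suc i))"
proof -
  have "(\<Sum>i<k. \<Sum>j<i. g j (i - Suc j) (k - Suc i))
      = (\<Sum>(i, j)\<in>Sigma {..<k} (\<lambda>i. {..<i}). g j (i - Suc j) (k - Suc i))"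
    by (rule sum.Sigma) auto
  also have "\<dots> = (\<Sum>(j, i)\<in>Sigma {..<k} (\<lambda>j. {..<k - Suc j}). g j i (k - Suc j - Suc i))"
    by (rule sum.reindex_bij_witness
        [where i = "\<lambda>(j, i). (Suc (j + i), j)" and j = "\<lambda>(i, j). (j, i - Suc j)"]) auto
  also have "\<dots> = (\<Sum>j<k. \<Sum>i<k - Suc j. g j i (k - Suc j - Suc i))"
    by (rule sum.Sigma [symmetric]) auto
  finally show ?thesis .
qed

lemma antipode_letter_right:
  "antipode_letter k = - monomial [k] + (\<Sum>i<k. monomial [i] * antipode_letter (k - Suc i))"
proof (induction k rule: less_induct)
  case (less k)
  let ?m = "\<lambda>i. monomial [i] :: 'a ypoly" and ?s = "antipode_letter :: nat \<Rightarrow> 'a ypoly"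
  have "(\<Sum>i<k. ?s i * ?m (k - Suc i)) =
      (\<Sum>i<k. - (?m i * ?m (k - Suc i)) + (\<Sum>j<i. ?m j * ?s (i - Suc j) * ?m (k - Suc i)))"
    by (rule sum.cong) (simp_all only: less lessThan_iff distrib_right sum_distrib_right minus_mult_left)
  also have "\<dots> = (\<Sum>i<k. - (?m i * ?m (k - Suc i)))
      + (\<Sum>j<k. \<Sum>i<k - Suc j. ?m j * ?s i * ?m (k - Suc j - Suc i))"
    using sum_triangle [of "\<lambda>a b c. ?m a * ?s b * ?m c"] by (simp only: sum.distrib)
  also have "\<dots> = (\<Sum>j<k. ?m j * ?s (k - Suc j))"
  proof -
    have "?m j * ?s (k - Suc j) = - (?m j * ?m (k - Suc j))
        + (\<Sum>i<k - Suc j. ?m j * ?s i * ?m (k - Suc j - Suc i))" for j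
      by (subst antipode_letter_left)
        (simp only: distrib_left sum_distrib_left mult.assoc mult_minus_right)
    then show ?thesis by (simp only: sum.distrib)
  qed
  finally show ?case
    by (subst antipode_letter_left) simp
qed

fun antipode_word :: "yword \<Rightarrow> ('k::ring_1) ypoly" where
  "antipode_word [] = 1"
| "antipode_word (k # u) = antipode_word u * antipode_letter k"

lemma antipode_word_append: "antipode_word (u @ v) = antipode_word v * antipode_word u"
  by (induction u) (simp_all add: mult.assoc)

lemma coproduct_word_Nil: "harmonic_coproduct_word [] = monomial ([], [])"
  by (simp add: harmonic_coproduct_word_def single_one [symmetric] zero_prod_def zero_list_def)

lemma coproduct_word_Cons:
  "harmonic_coproduct_word (k # u) = harmonic_coproduct_gen (Suc k) * harmonic_coproduct_word u"
  by (simp add: harmonic_coproduct_word_def)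

abbreviation "conv_left \<equiv> lin_ext (\<lambda>(u, v). antipode_word u * monomial v)"
abbreviation "conv_right \<equiv> lin_ext (\<lambda>(u, v). monomial u * antipode_word v)"

lemma monomial_mult: "monomial (u @ v) = monomial u * (monomial v :: 'k::ring_1 ypoly)"
  by (simp add: mult_single plus_list_def)

lemma monomial_Nil: "monomial [] = (1 :: 'k::ring_1 ypoly)"
  by (simp add: single_one [symmetric] zero_list_def)

lemma conv_left_mult:
  "conv_left (p * q) = lin_ext (\<lambda>(u, v). antipode_word u * conv_left p * monomial v) (q :: 'k::comm_ring_1 ytensor)"
proof (induction p rule: poly_induct)
  case (single w c)
  show ?case
  proof (induction q rule: poly_induct)
    case (single x d)
    obtain w1 w2 x1 x2 where [simp]: "w = (w1, w2)" "x = (x1, x2)" by (metis surj_pair)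
    have "conv_left (Poly_Mapping.single w c * Poly_Mapping.single x d) =
        const d * const c * (antipode_word x1 * antipode_word w1 * (monomial w2 * monomial x2))"
      by (simp add: mult_single lin_ext_single plus_list_def zero_list_def antipode_word_append
          monomial_mult [symmetric] mult.commute [of c])
    then show ?case
      by (simp add: lin_ext_single mult.assoc const_commute [of c])
  qed (simp add: lin_ext_add distrib_left)
next
  case (add p p')
  have "lin_ext (\<lambda>(u, v). antipode_word u * conv_left (p + p') * monomial v) q =
      lin_ext (\<lambda>(u, v). antipode_word u * conv_left p * monomial v) q
      + lin_ext (\<lambda>(u, v). antipode_word u * conv_left p' * monomial v) q"
    by (simp add: lin_ext_def lin_ext_add [unfolded lin_ext_def] case_prod_beta distrib_left
        distrib_right sum.distrib)
  with add show ?case by (simp add: distrib_right lin_ext_add)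
qed

lemma conv_right_mult:
  "conv_right (p * q) = lin_ext (\<lambda>(u, v). monomial u * conv_right q * antipode_word v) (p :: 'k::comm_ring_1 ytensor)"
proof (induction p rule: poly_induct)
  case (single w c)
  show ?case
  proof (induction q rule: poly_induct)
    case (single x d)
    obtain w1 w2 x1 x2 where [simp]: "w = (w1, w2)" "x = (x1, x2)" by (metis surj_pair)
    have "conv_right (Poly_Mapping.single w c * Poly_Mapping.single x d) =
        const c * const d * (monomial w1 * monomial x1 * (antipode_word x2 * antipode_word w2))"
      by (simp add: mult_single lin_ext_single plus_list_def zero_list_def antipode_word_append
          monomial_mult [symmetric])
    then show ?case
      by (simp add: lin_ext_single mult.assoc const_commute [of d])
  qed (simp add: lin_ext_add distrib_left lin_ext_single distrib_right case_prod_beta)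
qed (simp add: lin_ext_add distrib_right)

lemma conv_left_gen: "conv_left (harmonic_coproduct_gen (Suc k)) = 0"
  by (simp add: harmonic_coproduct_gen_Suc lin_ext_add lin_ext_const_diff lin_ext_sum lin_ext_single
      monomial_Nil antipode_letter_left [of k])

lemma conv_right_gen: "conv_right (harmonic_coproduct_gen (Suc k)) = 0"
  by (simp add: harmonic_coproduct_gen_Suc lin_ext_add lin_ext_const_diff lin_ext_sum lin_ext_single
      monomial_Nil antipode_letter_right [of k])

lemma conv_left_word:
  "conv_left (harmonic_coproduct_word u) = (if u = [] then 1 else (0 :: 'k::comm_ring_1 ypoly))"
proof (cases u)
  case Nil
  then show ?thesis by (simp add: coproduct_word_Nil lin_ext_single monomial_Nil)
next
  case (Cons k u)
  then show ?thesis
    by (simp add: coproduct_word_Cons conv_left_mult conv_left_gen)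
qed

lemma conv_right_word:
  "conv_right (harmonic_coproduct_word u) = (if u = [] then 1 else (0 :: 'k::comm_ring_1 ypoly))"
proof (induction u)
  case Nil
  then show ?case by (simp add: coproduct_word_Nil lin_ext_single monomial_Nil)
next
  case (Cons k u)
  show ?case
  proof (cases "u = []")
    case True
    then show ?thesis
      by (simp add: harmonic_coproduct_word_def conv_right_gen)
  next
    case False
    with Cons show ?thesis
      by (simp add: coproduct_word_Cons conv_right_mult)
  qed
qed

lemma linear_const_counit: "is_linear (\<lambda>p. const (harmonic_counit p) :: 'k::comm_ring_1 ypoly)"
proof -
  have "Poly_Mapping.lookup (const c * p) [] = c * Poly_Mapping.lookup p []" for c and p :: "'k ypoly"
    by (induction p rule: poly_induct)
      (auto simp: mult_single lookup_single when_def distrib_left lookup_add)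
  then show ?thesis
    by (simp add: is_linear_def harmonic_counit_def lookup_add single_add const_mult)
qed

lemma linear_convolve: "is_linear (convolve f g)"
  by (simp add: is_linear_def convolve_def harmonic_coproduct_def lin_ext_add lin_ext_const)

lemma convolve_monomial:
  "convolve f g (monomial u)
     = lin_ext (\<lambda>(u, v). f (monomial u) * g (monomial v)) (harmonic_coproduct_word u)"
  by (simp add: convolve_def harmonic_coproduct_def lin_ext_single)

lemma lin_ext_antipode_word: "is_harmonic_antipode (lin_ext antipode_word :: _ \<Rightarrow> 'k::comm_ring_1 ypoly)"
proof -
  have eps: "const (harmonic_counit (monomial u)) = (if u = [] then 1 else (0 :: 'k ypoly))" for u
    by (simp add: harmonic_counit_def lookup_single)
  have "convolve (lin_ext antipode_word) (\<lambda>q. q) = (\<lambda>p. const (harmonic_counit p) :: 'k ypoly)"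
    by (rule linear_eqI [OF linear_convolve linear_const_counit], unfold convolve_monomial eps)
      (simp add: conv_left_word [symmetric] lin_ext_single)
  moreover have "convolve (\<lambda>q. q) (lin_ext antipode_word) = (\<lambda>p. const (harmonic_counit p) :: 'k ypoly)"
    by (rule linear_eqI [OF linear_convolve linear_const_counit], unfold convolve_monomial eps)
      (simp add: conv_right_word [symmetric] lin_ext_single)
  ultimately show ?thesis
    by (simp add: is_harmonic_antipode_def linear_lin_ext fun_eq_iff)
qed

lemma weight_simps [simp]: "weight [] = 0" "weight (k # u) = Suc k + weight u"
  "weight (u @ v) = weight u + weight v"
  by (simp_all add: weight_def)

lemma coproduct_word_triangular:
  "\<exists>r. harmonic_coproduct_word u = monomial (u, []) + (r :: 'k::ring_1 ytensor) \<and>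
       (\<forall>(v, w)\<in>Poly_Mapping.keys r. weight v < weight u)"
proof (induction u)
  case Nil
  show ?case by (rule exI [of _ 0]) (simp add: coproduct_word_Nil)
next
  case (Cons k u)
  then obtain r :: "'k ytensor" where r: "harmonic_coproduct_word u = monomial (u, []) + r"
    "\<And>v w. (v, w) \<in> Poly_Mapping.keys r \<Longrightarrow> weight v < weight u" by blast
  define g :: "'k ytensor" where
    "g = monomial ([], [k]) - (\<Sum>i<k. monomial ([i], [k - Suc i]))"
  have g: "weight v < Suc k" if "(v, w) \<in> Poly_Mapping.keys g" for v w
    using that by (auto simp: g_def in_keys_iff lookup_minus lookup_sum lookup_single when_def
        split: if_splits elim!: sum.not_neutral_contains_not_neutral)
  let ?a = "monomial ([k], []) :: 'k ytensor"
  have "harmonic_coproduct_word (k # u) = (?a + g) * (monomial (u, []) + r)"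
    by (simp add: coproduct_word_Cons r(1) g_def harmonic_coproduct_gen_Suc add_diff_eq)
  also have "\<dots> = monomial (k # u, []) + (?a * r + g * (monomial (u, []) + r))"
    by (simp add: distrib_left distrib_right mult_single plus_list_def)
  finally have eq: "harmonic_coproduct_word (k # u) = \<dots>" .
  have "weight v < weight (k # u)" if "(v, w) \<in> Poly_Mapping.keys (?a * r)" for v w
    using that keys_mult [of ?a r] by (auto simp: plus_list_def dest!: r(2))
  moreover have "weight v < weight (k # u)"
    if vw: "(v, w) \<in> Poly_Mapping.keys (g * (monomial (u, []) + r))" for v w
  proof -
    from subsetD [OF keys_mult vw] obtain v1 w1 v2 w2 where
      "(v, w) = (v1, w1) + (v2, w2)" "(v1, w1) \<in> Poly_Mapping.keys g"
      "(v2, w2) \<in> Poly_Mapping.keys (monomial (u, []) + r)"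
      by auto
    moreover from this(3) have "weight v2 \<le> weight u"
      using keys_add [of "monomial (u, [])" r] by (auto dest!: r(2))
    ultimately show ?thesis using g by (fastforce simp: plus_list_def)
  qed
  ultimately show ?case
    using eq keys_add [of "?a * r" "g * (monomial (u, []) + r)"] by blast
qed

lemma left_inverse_unique:
  fixes S T :: "'k ypoly \<Rightarrow> 'k::ring_1 ypoly"
  assumes "is_linear S" "is_linear T"
    and "convolve S (\<lambda>q. q) = convolve T (\<lambda>q. q)"
  shows "S = T"
proof (rule linear_eqI [OF assms(1,2)])
  fix u
  show "S (monomial u) = T (monomial u)"
  proof (induction "weight u" arbitrary: u rule: less_induct)
    case less
    obtain r :: "'k ytensor" where r: "harmonic_coproduct_word u = monomial (u, []) + r"
      "\<And>v w. (v, w) \<in> Poly_Mapping.keys r \<Longrightarrow> weight v < weight u"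
      using coproduct_word_triangular by blast
    have "lin_ext (\<lambda>(u, v). S (monomial u) * monomial v) r = lin_ext (\<lambda>(u, v). T (monomial u) * monomial v) r"
      unfolding lin_ext_def
    proof (rule sum.cong [OF refl])
      fix x assume "x \<in> Poly_Mapping.keys r"
      moreover obtain v w where "x = (v, w)" by (cases x)
      moreover from calculation have "S (monomial v) = T (monomial v)"
        by (intro less r(2)) auto
      ultimately show "const (Poly_Mapping.lookup r x) * (case x of (u, v) \<Rightarrow> S (monomial u) * monomial v)
          = const (Poly_Mapping.lookup r x) * (case x of (u, v) \<Rightarrow> T (monomial u) * monomial v)"
        by simp
    qed
    moreover have "convolve S (\<lambda>q. q) (monomial u) = convolve T (\<lambda>q. q) (monomial u)"
      using assms(3) by simp
    ultimately show ?case
      by (simp add: convolve_monomial r(1) lin_ext_add lin_ext_single monomial_Nil)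
  qed
qed

lemma harmonic_antipode_unique_exists:
  "\<exists>!S. is_harmonic_antipode (S :: 'k ypoly \<Rightarrow> 'k::comm_ring_1 ypoly)"
proof (rule ex1I)
  show "is_harmonic_antipode (lin_ext antipode_word :: _ \<Rightarrow> 'k ypoly)"
    by (rule lin_ext_antipode_word)
next
  fix S :: "'k ypoly \<Rightarrow> 'k ypoly"
  assume "is_harmonic_antipode S"
  then have "is_linear S" "convolve S (\<lambda>q. q) = convolve (lin_ext antipode_word) (\<lambda>q. q)"
    using lin_ext_antipode_word [where 'k = 'k] unfolding is_harmonic_antipode_def by auto
  then show "S = lin_ext antipode_word"
    by (rule left_inverse_unique [OF _ linear_lin_ext])
qed



lemma harmonic_antipode_poly_monomial:
  "harmonic_antipode_poly (monomial u) = (antipode_word u :: 'k::comm_ring_1 ypoly)"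
proof -
  have "harmonic_antipode_poly = (lin_ext antipode_word :: _ \<Rightarrow> 'k ypoly)"
    unfolding harmonic_antipode_poly_def
    by (rule the1_equality) (rule harmonic_antipode_unique_exists lin_ext_antipode_word)+
  then have "harmonic_antipode_poly (monomial u) = lin_ext antipode_word (monomial u :: 'k ypoly)"
    by (rule fun_cong)
  then show ?thesis by (simp add: lin_ext_single)
qed

lemma keys_mult_weight:
  fixes p q :: "'k::ring_1 ypoly"
  assumes "\<And>w. w \<in> Poly_Mapping.keys p \<Longrightarrow> weight w = m"
    and "\<And>w. w \<in> Poly_Mapping.keys q \<Longrightarrow> weight w = n"
    and "w \<in> Poly_Mapping.keys (p * q)"
  shows "weight w = m + n"
  using assms keys_mult [of p q] by (fastforce simp: plus_list_def)

lemma antipode_letter_weight: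
  "w \<in> Poly_Mapping.keys (antipode_letter k :: 'k::ring_1 ypoly) \<Longrightarrow> weight w = Suc k"
proof (induction k arbitrary: w rule: less_induct)
  case (less k)
  have "w \<in> Poly_Mapping.keys (- monomial [k] + (\<Sum>i<k. antipode_letter i * monomial [k - Suc i]) :: 'k ypoly)"
    using less.prems by (simp only: antipode_letter_left [of k, symmetric])
  then have "w = [k] \<or>
      (\<exists>i<k. w \<in> Poly_Mapping.keys ((antipode_letter i :: 'k ypoly) * monomial [k - Suc i]))"
    unfolding in_keys_iff lookup_add lookup_sum lookup_uminus lookup_single
    by (auto simp: when_def split: if_splits elim!: sum.not_neutral_contains_not_neutral)
  moreover have "weight w = Suc k"
    if "i < k" "w \<in> Poly_Mapping.keys ((antipode_letter i :: 'k ypoly) * monomial [k - Suc i])" for i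
    using keys_mult_weight [OF _ _ that(2), of "Suc i" "k - i"] less.IH that(1) by auto
  ultimately show ?case by auto
qed

lemma harmonic_antipode_weight:
  fixes u :: yword
  assumes "w \<in> Poly_Mapping.keys (harmonic_antipode_poly (monomial u) :: 'k::comm_ring_1 ypoly)"
  shows "weight w = weight u"
  using assms unfolding harmonic_antipode_poly_monomial
proof (induction u arbitrary: w)
  case Nil
  then show ?case by (simp add: zero_list_def)
next
  case (Cons k u)
  from keys_mult_weight [OF Cons.IH antipode_letter_weight] Cons.prems
  have "weight w = weight u + Suc k" by simp
  then show ?case by simp
qed

end

(*
  Write z = -x-y and Q' = Q(z,y), and let psi = psi_x x + psi_y y = x psi^x + y psi^y. The
  series 1 - sum Y_m is grouplike, so S_* is the antiautomorphism x^(m-1) y |-> -(x+y)^(m-1) y.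
  As reversing words with the sign (-1)^length negates a Lie series, condition (1) says that
  G := psi_y - (psi^y)' is the series in y alone with coefficients ((-1)^m - 1) c_(m+1) / (m+1),
  where c_(m+1) = (psi | x^m y). On the other hand

    [psi, x] + [psi', z] = x A x + z A' z + x G z + z G' x,   A = psi^x - psi^y - psi_x + psi_y.

  If (2) holds, then G = A = 0 since x, z are free generators, and the coefficients of A at x^m
  together with the reversal symmetry give c_(m+1) = 0 for odd m. If (1) holds, then G = G'
  has in the letters x, z coefficients g_m depending only on the length m of the word. The
  right-hand side is a Lie series, hence orthogonal to shuffle products with a letter; two such
  relations give (2 - m (m+1)) g_m = 0, so G = 0 as psi has no terms of degree less than 3.
  A Lie series without words that begin with x and end with z has no terms of degree at least
  2, because such words span modulo shuffle products (they include the Lyndon words).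
*)

theory Submission
  imports Defs
begin

section \<open>Coefficients of series\<close>

lemma coeff_basics [simp]:
  fixes P Q :: "('a, 'k::ring_1) ncps"
  shows "coeff (0 :: ('a, 'k) ncps) w = 0"
    and "coeff (1 :: ('a, 'k) ncps) w = (if w = [] then 1 else 0)"
    and "coeff (P + Q) w = coeff P w + coeff Q w"
    and "coeff (P - Q) w = coeff P w - coeff Q w"
    and "coeff (- P) w = - coeff P w"
    and "coeff (scale c P) w = c * coeff P w"
    and "coeff (gen a :: ('a, 'k) ncps) w = (if w = [a] then 1 else 0)"
    and "coeff (homogeneous_part n P) w = (if length w = n then coeff P w else 0)"
  by (simp_all add: zero_ncps_def one_ncps_def plus_ncps_def minus_ncps_def uminus_ncps_def
      scale_def gen_def homogeneous_part_def)

lemma coeff_right_factor [simp]: "coeff (right_factor a P) w = coeff P (w @ [a])"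
  by (simp add: right_factor_def)

text \<open>This gives the psi^x and psi^y of the overview. Most inductions on a word keep the
  series arbitrary and pass to a left factor.\<close>

definition left_factor :: "'a \<Rightarrow> ('a, 'k) ncps \<Rightarrow> ('a, 'k) ncps"
  where "left_factor a P = NCPS (\<lambda>w. coeff P (a # w))"

lemma coeff_left_factor [simp]: "coeff (left_factor a P) w = coeff P (a # w)"
  by (simp add: left_factor_def)

lemma left_factor_linear [simp]:
  fixes P Q :: "('a, 'k::ring_1) ncps"
  shows "left_factor a (P + Q) = left_factor a P + left_factor a Q"
    and "left_factor a (scale c P) = scale c (left_factor a P)"
  by (rule ncps_eqI, simp)+

lemma coeff_times_Nil [simp]:
  "coeff (P * Q) [] = coeff P [] * coeff Q ([] :: 'a list)" for P Q :: "('a, 'k::ring_1) ncps"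
  by (simp add: times_ncps_def)

lemma coeff_times_Cons:
  fixes P Q :: "('a, 'k::ring_1) ncps"
  shows "coeff (P * Q) (a # w) = coeff P [] * coeff Q (a # w) + coeff (left_factor a P * Q) w"
  by (simp add: times_ncps_def sum.atMost_Suc_shift del: sum.atMost_Suc)

text \<open>The Leibniz rule of a Fox derivative: the cut before the first letter gives the first
  term, all later cuts the second.\<close>

lemma left_factor_times:
  fixes P Q :: "('a, 'k::ring_1) ncps"
  shows "left_factor a (P * Q) = scale (coeff P []) (left_factor a Q) + left_factor a P * Q"
  by (rule ncps_eqI) (simp add: coeff_times_Cons)

lemma scale_times [simp]:
  fixes P Q :: "('a, 'k::comm_ring_1) ncps"
  shows "scale c P * Q = scale c (P * Q)" "P * scale c Q = scale c (P * Q)"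
  by (rule ncps_eqI, simp add: times_ncps_def sum_distrib_left mult_ac)+

lemma coeff_gen_times_Cons [simp]:
  fixes P :: "('a, 'k::ring_1) ncps"
  shows "coeff (gen a * P) (b # w) = (if a = b then coeff P w else 0)"
proof -
  have "left_factor b (gen a :: ('a, 'k) ncps) = (if a = b then 1 else 0)"
    by (rule ncps_eqI) auto
  then show ?thesis by (simp add: coeff_times_Cons)
qed

lemma coeff_times_gen_snoc [simp]:
  fixes P :: "('a, 'k::ring_1) ncps"
  shows "coeff (P * gen a) (w @ [b]) = (if a = b then coeff P w else 0)"
  by (induction w arbitrary: P) (auto simp: coeff_times_Cons)

section \<open>Decompositions by first and last letters\<close>

lemma left_decomposition:
  fixes P :: "'k::ring_1 series"
  assumes "coeff P [] = 0"
  shows "P = gen X * left_factor X P + gen Y * left_factor Y P"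
proof (rule ncps_eqI)
  fix w
  show "coeff P w = coeff (gen X * left_factor X P + gen Y * left_factor Y P) w"
  proof (cases w)
    case (Cons a u)
    then show ?thesis by (cases a) simp_all
  qed (use assms in simp)
qed

lemma right_decomposition:
  fixes P :: "'k::ring_1 series"
  assumes "coeff P [] = 0"
  shows "P = right_factor X P * gen X + right_factor Y P * gen Y"
proof (rule ncps_eqI)
  fix w
  show "coeff P w = coeff (right_factor X P * gen X + right_factor Y P * gen Y) w"
  proof (cases w rule: rev_cases)
    case (snoc u a)
    then show ?thesis by (cases a) simp_all
  qed (use assms in simp)
qed

lemma coeff_two_sided:
  fixes P :: "('a, 'k::ring_1) ncps"
  shows "coeff (gen a * P * gen b) (c # w @ [d]) = (if a = c \<and> b = d then coeff P w else 0)"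
proof -
  have "coeff (gen a * P * gen b) ((c # w) @ [d]) = (if b = d then coeff (gen a * P) (c # w) else 0)"
    by (rule coeff_times_gen_snoc)
  then show ?thesis by auto
qed

lemma letter_UNIV: "(UNIV :: letter set) = {X, Y}"
proof -
  have "a \<in> {X, Y}" for a by (cases a) simp_all
  then show ?thesis by blast
qed

lemma finite_letter [simp]: "finite (UNIV :: letter set)"
  by (simp add: letter_UNIV)

lemma finite_words_length [simp]: "finite {v :: letter list. length v = n}"
  using finite_lists_length_eq [OF finite_letter, of n] by simp

lemma sum_words_Suc:
  "(\<Sum>v | length v = Suc n. f v) = (\<Sum>v | length v = n. f (X # v)) + (\<Sum>v | length v = n. f (Y # v))"
  for f :: "letter list \<Rightarrow> 'm::comm_monoid_add"
proof -
  have "{v :: letter list. length v = Suc n}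
      = (#) X ` {v. length v = n} \<union> (#) Y ` {v. length v = n}"
    using letter_UNIV by (fastforce simp: length_Suc_conv)
  moreover have "sum f ((#) X ` {v. length v = n} \<union> (#) Y ` {v. length v = n})
      = sum f ((#) X ` {v. length v = n}) + sum f ((#) Y ` {v. length v = n})"
    by (rule sum.union_disjoint) auto
  ultimately show ?thesis by (simp add: sum.reindex)
qed


section \<open>Linear substitutions\<close>

text \<open>Substituting such forms preserves degree, so each coefficient of the result involves
  only words of its own length.\<close>

definition linear_form :: "('a, 'k::ring_1) ncps \<Rightarrow> bool"
  where "linear_form s \<longleftrightarrow> (\<forall>w. length w \<noteq> 1 \<longrightarrow> coeff s w = 0)"

lemma linear_form_closed [simp]:
  "linear_form (gen a)" "linear_form s \<Longrightarrow> linear_form (- s)"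
  "linear_form s \<Longrightarrow> linear_form t \<Longrightarrow> linear_form (s - t)"
  by (auto simp: linear_form_def)

lemma linear_form_Nil [simp]: "linear_form s \<Longrightarrow> coeff s [] = 0"
  by (simp add: linear_form_def)

text \<open>The left factors of a linear form are constants, so multiplying by it affects the first
  letter only.\<close>

lemma coeff_linear_form_times_Cons:
  fixes P :: "('a, 'k::ring_1) ncps"
  assumes "linear_form s"
  shows "coeff (s * P) (a # w) = coeff s [a] * coeff P w"
proof -
  have "left_factor a s = scale (coeff s [a]) 1"
    using assms by (intro ncps_eqI) (simp add: linear_form_def)
  then have "coeff (left_factor a s * P) w = coeff (scale (coeff s [a]) 1 * P) w" by simp
  \<comment> \<open>\<open>scale_times\<close> assumes commutative coefficients; here a constant
    left factor leaves only the cut at 0.\<close>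
  also have "scale (coeff s [a]) 1 * P = scale (coeff s [a]) P"
  proof (rule ncps_eqI)
    fix v
    have "coeff (scale (coeff s [a]) 1 * P) v = (\<Sum>i\<in>{0}. coeff s [a] * coeff P (drop i v))"
      unfolding times_ncps_def coeff_NCPS by (rule sum.mono_neutral_cong_right) auto
    then show "coeff (scale (coeff s [a]) 1 * P) v = coeff (scale (coeff s [a]) P) v" by simp
  qed
  finally show ?thesis using assms by (simp add: coeff_times_Cons)
qed

lemma linear_form_letter_val:
  "linear_form s \<Longrightarrow> linear_form t \<Longrightarrow> linear_form (letter_val s t a)"
  by (cases a) simp_all

lemma coeff_word_val_eq_0:
  assumes "linear_form s" "linear_form t" "length v \<noteq> length w"
  shows "coeff (prod_list (map (letter_val s t) v)) w = 0"
  using assms(3)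
proof (induction v arbitrary: w)
  case (Cons a v)
  then show ?case
    using assms(1,2)
    by (cases w) (simp_all add: coeff_linear_form_times_Cons linear_form_letter_val)
qed simp

lemma coeff_subst_linear:
  fixes P :: "'k::ring_1 series"
  assumes "linear_form s" "linear_form t"
  shows "coeff (subst P s t) w
    = (\<Sum>v | length v = length w. coeff P v * coeff (prod_list (map (letter_val s t) v)) w)"
proof -
  have "finite {v :: letter list. length v \<le> length w}"
    using finite_lists_length_le [OF finite_letter, of "length w"] by simp
  then show ?thesis
    unfolding subst_def coeff_NCPS
    by (intro sum.mono_neutral_right) (auto simp: coeff_word_val_eq_0 [OF assms])
qed

lemma coeff_subst_Nil [simp]: "coeff (subst P s t) [] = coeff P []"
  by (simp add: subst_def)

text \<open>Split the words \<open>v\<close> by their first letter. This recursion replaces the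
  defining sum in the inductions below.\<close>

lemma coeff_subst_Cons:
  fixes P :: "'k::comm_ring_1 series"
  assumes "linear_form s" "linear_form t"
  shows "coeff (subst P s t) (a # w)
    = coeff s [a] * coeff (subst (left_factor X P) s t) w
      + coeff t [a] * coeff (subst (left_factor Y P) s t) w"
  using assms
  by (simp add: coeff_subst_linear sum_words_Suc coeff_linear_form_times_Cons sum_distrib_left mult_ac)

context
  fixes s t :: "'k::comm_ring_1 series"
  assumes linear: "linear_form s" "linear_form t"
begin

lemma subst_add: "subst (P + Q) s t = subst P s t + subst Q s t"
  by (rule ncps_eqI) (simp add: subst_def sum.distrib distrib_right)

lemma subst_diff: "subst (P - Q) s t = subst P s t - subst Q s t"
  by (rule ncps_eqI) (simp add: subst_def sum_subtractf left_diff_distrib)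

lemma subst_minus: "subst (- P) s t = - subst P s t"
  by (rule ncps_eqI) (simp add: subst_def sum_negf)

lemma subst_zero: "subst 0 s t = 0"
  by (rule ncps_eqI) (simp add: subst_def)

lemma subst_scale: "subst (scale c P) s t = scale c (subst P s t)"
  by (rule ncps_eqI) (simp add: subst_def sum_distrib_left mult.assoc)

lemma subst_gen: "subst (gen a) s t = letter_val s t a"
proof (rule ncps_eqI)
  fix w
  have "left_factor b (gen a) = (if a = b then 1 else 0 :: 'k series)" for b
    by (rule ncps_eqI) auto
  moreover have "subst 1 s t = 1"
  proof (rule ncps_eqI)
    fix u
    have "left_factor b 1 = (0 :: 'k series)" for b
      by (rule ncps_eqI) simp
    then show "coeff (subst 1 s t) u = coeff 1 u"
      by (cases u) (simp_all add: coeff_subst_Cons [OF linear] subst_zero)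
  qed
  ultimately show "coeff (subst (gen a) s t) w = coeff (letter_val s t a) w"
    using linear by (cases a; cases w) (auto simp: coeff_subst_Cons subst_zero linear_form_def)
qed

text \<open>Both sides obey the same recursion in the first letter of \<open>w\<close>, by
  \<open>left_factor_times\<close>; \<open>P\<close> varies while \<open>Q\<close> stays
  fixed.\<close>

lemma subst_times: "subst (P * Q) s t = subst P s t * subst Q s t"
proof (rule ncps_eqI)
  fix w
  show "coeff (subst (P * Q) s t) w = coeff (subst P s t * subst Q s t) w"
  proof (induction w arbitrary: P)
    case (Cons a w)
    have "left_factor a (subst P s t) = scale (coeff s [a]) (subst (left_factor X P) s t)
        + scale (coeff t [a]) (subst (left_factor Y P) s t)" for P
      by (rule ncps_eqI) (simp add: coeff_subst_Cons [OF linear])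
    with Cons show ?case
      by (simp add: coeff_subst_Cons [OF linear] left_factor_times subst_add subst_scale
          coeff_times_Cons algebra_simps)
  qed simp
qed

lemma homogeneous_part_subst:
  "homogeneous_part n (subst P s t) = subst (homogeneous_part n P) s t"
  by (rule ncps_eqI) (auto simp: coeff_subst_linear [OF linear] intro!: sum.cong sum.neutral)

lemma subst_lie_polynomial:
  assumes "P \<in> lie_polynomials" "s \<in> lie_polynomials" "t \<in> lie_polynomials"
  shows "subst P s t \<in> lie_polynomials"
  using assms(1)
proof induction
  case (gen a)
  then show ?case using assms by (cases a) (simp_all add: subst_gen)
qed (auto simp: subst_zero subst_add subst_scale commutator_def subst_diff subst_times
      intro: lie_polynomials.intros lie_polynomials.bracket [unfolded commutator_def])

lemma subst_lie_series:
  assumes "P \<in> lie_series" "s \<in> lie_polynomials" "t \<in> lie_polynomials"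
  shows "subst P s t \<in> lie_series"
  using assms by (simp add: lie_series_def homogeneous_part_subst subst_lie_polynomial)

text \<open>Linear substitutions compose like matrices, as \<open>coeff1\<close> shows; this makes
  the two flips below involutions.\<close>

lemma subst_subst:
  assumes "linear_form s'" "linear_form t'"
  shows "subst (subst P s' t') s t = subst P (subst s' s t) (subst t' s t)"
proof (rule ncps_eqI)
  fix w
  have lin: "linear_form (subst r s t)" if "linear_form r" for r
    using that by (auto simp: linear_form_def coeff_subst_linear [OF linear])
  have coeff1: "coeff (subst r s t) [a] = coeff r [X] * coeff s [a] + coeff r [Y] * coeff t [a]"
    if "linear_form r" for r a
    by (simp add: coeff_subst_Cons [OF linear] mult.commute)
  have "left_factor a (subst P s' t') = scale (coeff s' [a]) (subst (left_factor X P) s' t')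
      + scale (coeff t' [a]) (subst (left_factor Y P) s' t')" for a P
    by (rule ncps_eqI) (simp add: coeff_subst_Cons [OF assms])
  then show "coeff (subst (subst P s' t') s t) w = coeff (subst P (subst s' s t) (subst t' s t)) w"
    by (induction w arbitrary: P)
      (simp_all add: coeff_subst_Cons [OF linear] coeff_subst_Cons [OF lin lin] assms coeff1
        subst_add subst_scale algebra_simps)
qed

end

lemma gens_lie_polynomials:
  "gen X \<in> lie_polynomials" "- gen X - gen Y \<in> (lie_polynomials :: 'k::ring_1 series set)"
proof -
  have "- gen X - gen Y = scale (-1) (gen X) + scale (-1) (gen Y :: 'k series)"
    by (rule ncps_eqI) simp
  also have "\<dots> \<in> lie_polynomials" by (intro lie_polynomials.intros)
  finally show "- gen X - gen Y \<in> (lie_polynomials :: 'k series set)" .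
qed (rule lie_polynomials.gen)

lemma subst_gens: "subst P (gen X) (gen Y) = (P :: 'k::comm_ring_1 series)"
proof (rule ncps_eqI)
  fix w
  show "coeff (subst P (gen X) (gen Y)) w = coeff P w"
  proof (induction w arbitrary: P)
    case (Cons a w)
    then show ?case by (cases a) (simp_all add: coeff_subst_Cons)
  qed simp
qed


section \<open>Insertions of a letter\<close>

text \<open>The pairing of \<open>f\<close> with the shuffle product of the letter \<open>a\<close> and the word \<open>w\<close>.\<close>

fun insertions :: "('a list \<Rightarrow> 'k) \<Rightarrow> 'a \<Rightarrow> 'a list \<Rightarrow> 'k::comm_ring_1" where
  "insertions f a [] = f [a]"
| "insertions f a (b # w) = f (a # b # w) + insertions (\<lambda>v. f (b # v)) a w"

lemma insertions_add: "insertions (\<lambda>v. f v + g v) a w = insertions f a w + insertions g a w"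
  by (induction w arbitrary: f g) (simp_all add: algebra_simps)

lemma insertions_diff: "insertions (\<lambda>v. f v - g v) a w = insertions f a w - insertions g a w"
  by (induction w arbitrary: f g) (simp_all add: algebra_simps)

lemma insertions_cmult: "insertions (\<lambda>v. c * f v) a w = c * insertions f a w"
  by (induction w arbitrary: f) (simp_all add: algebra_simps)

lemma insertions_zero: "insertions (\<lambda>v. 0) a w = 0"
  by (induction w) simp_all

text \<open>The marked letter \<open>b\<close> separates the places of insertion: each lies either
  before it or after it.\<close>

lemma insertions_append:
  "insertions f a (u @ b # v)
     = insertions (\<lambda>p. f (p @ b # v)) a u + insertions (\<lambda>q. f (u @ b # q)) a v"
  by (induction u arbitrary: f) (simp_all add: algebra_simps)

lemma insertions_const:
  assumes "\<And>u v. w = u @ v \<Longrightarrow> f (u @ a # v) = c"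
  shows "insertions f a w = of_nat (Suc (length w)) * c"
  using assms
proof (induction w arbitrary: f)
  case Nil
  then show ?case by simp
next
  case (Cons b w)
  have "insertions (\<lambda>v. f (b # v)) a w = of_nat (Suc (length w)) * c"
  proof (rule Cons.IH)
    fix u v assume "w = u @ v"
    then show "f (b # u @ a # v) = c" using Cons.prems [of "b # u" v] by simp
  qed
  moreover have "f (a # b # w) = c" using Cons.prems [of "[]"] by simp
  ultimately show ?case by (simp add: algebra_simps)
qed

lemma insertions_replicate:
  "insertions f a (replicate n a) = of_nat (Suc n) * f (replicate (Suc n) a)"
proof -
  have "f (u @ a # v) = f (replicate (Suc n) a)" if "replicate n a = u @ v" for u v
  proof -
    have "replicate (Suc n) a = replicate (length u) a @ a # replicate (length v) a"
      using arg_cong [OF that, of length]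
      by (simp add: replicate_add replicate_app_Cons_same)
    moreover from that have "u = replicate (length u) a" "v = replicate (length v) a"
      by (metis append_eq_conv_conj length_append length_replicate take_replicate drop_replicate
          add_diff_cancel_left')+
    ultimately show ?thesis by simp
  qed
  from insertions_const [of "replicate n a" f a, OF this] show ?thesis by simp
qed

section \<open>The derivation dual to shuffling with a letter, and the shuffle relations of Lie
  series\<close>

definition letter_deriv :: "'a \<Rightarrow> ('a, 'k) ncps \<Rightarrow> ('a, 'k::comm_ring_1) ncps"
  where "letter_deriv a P = NCPS (insertions (coeff P) a)"

lemma coeff_letter_deriv [simp]: "coeff (letter_deriv a P) w = insertions (coeff P) a w"
  by (simp add: letter_deriv_def)

lemma coeff_left_factor_fun: "coeff (left_factor b P) = (\<lambda>v. coeff P (b # v))"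
  by (simp add: fun_eq_iff)

lemma left_factor_letter_deriv:
  "left_factor b (letter_deriv a P) = left_factor b (left_factor a P) + letter_deriv a (left_factor b P)"
  by (rule ncps_eqI) (simp add: coeff_left_factor_fun)

lemma letter_deriv_linear:
  shows "letter_deriv a (P + Q) = letter_deriv a P + letter_deriv a Q"
    and "letter_deriv a (P - Q) = letter_deriv a P - letter_deriv a Q"
    and "letter_deriv a (scale c P) = scale c (letter_deriv a P)"
    and "letter_deriv a 0 = (0 :: ('a, 'k::comm_ring_1) ncps)"
proof -
  have eqs: "coeff (P + Q) = (\<lambda>v. coeff P v + coeff Q v)" "coeff (P - Q) = (\<lambda>v. coeff P v - coeff Q v)"
    "coeff (scale c P) = (\<lambda>v. c * coeff P v)" "coeff (0 :: ('a, 'k) ncps) = (\<lambda>v. 0)"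
    by (simp_all add: fun_eq_iff)
  show "letter_deriv a (P + Q) = letter_deriv a P + letter_deriv a Q"
    "letter_deriv a (P - Q) = letter_deriv a P - letter_deriv a Q"
    "letter_deriv a (scale c P) = scale c (letter_deriv a P)"
    "letter_deriv a 0 = (0 :: ('a, 'k) ncps)"
    by (rule ncps_eqI, simp add: eqs insertions_add insertions_diff insertions_cmult insertions_zero)+
qed

text \<open>For every cut of the enlarged word, the inserted letter lies in exactly one of the two
  parts.\<close>

lemma letter_deriv_times: "letter_deriv a (P * Q) = letter_deriv a P * Q + P * letter_deriv a Q"
proof (rule ncps_eqI)
  fix w
  show "coeff (letter_deriv a (P * Q)) w = coeff (letter_deriv a P * Q + P * letter_deriv a Q) w"
  proof (induction w arbitrary: P)
    case Nil
    then show ?case by (simp add: coeff_times_Cons)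
  next
    case (Cons b w)
    have "coeff (letter_deriv a (P * Q)) (b # w) = coeff (left_factor b (letter_deriv a (P * Q))) w"
      by (simp only: coeff_left_factor)
    also have "\<dots> = coeff (letter_deriv a P * Q + P * letter_deriv a Q) (b # w)"
      unfolding left_factor_letter_deriv
      by (simp add: left_factor_times letter_deriv_linear Cons coeff_times_Cons
          left_factor_letter_deriv distrib_right del: coeff_letter_deriv)
        (simp add: coeff_left_factor_fun algebra_simps)
    finally show ?case .
  qed
qed

text \<open>The part of Ree's criterion for Lie series that concerns shuffles with a single letter.
  Equivalently, the constant term is 0 and all \<open>letter_deriv a P\<close> are
  constants.\<close>

definition shuffle_primitive :: "('a, 'k::comm_ring_1) ncps \<Rightarrow> bool"
  where "shuffle_primitive P \<longleftrightarrow>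
    coeff P [] = 0 \<and> (\<forall>a w. w \<noteq> [] \<longrightarrow> insertions (coeff P) a w = 0)"

lemma letter_deriv_primitive:
  assumes "shuffle_primitive P"
  shows "letter_deriv a P = scale (coeff P [a]) 1"
  by (rule ncps_eqI) (use assms in \<open>auto simp: shuffle_primitive_def\<close>)

text \<open>The derivatives of \<open>P\<close> and \<open>Q\<close> are scalars, so the Leibniz
  terms of \<open>P * Q\<close> and \<open>Q * P\<close> cancel.\<close>

lemma shuffle_primitive_commutator:
  assumes "shuffle_primitive P" "shuffle_primitive Q"
  shows "shuffle_primitive (commutator P Q)"
proof -
  have "letter_deriv a (commutator P Q) = 0" for a
    by (simp add: commutator_def letter_deriv_linear letter_deriv_times letter_deriv_primitive assms)
  then have "insertions (coeff (commutator P Q)) a w = 0" for a w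
    by (metis coeff_letter_deriv coeff_basics(1))
  then show ?thesis by (simp add: shuffle_primitive_def commutator_def)
qed

lemma shuffle_primitiveI:
  fixes P :: "('a, 'k::comm_ring_1) ncps"
  assumes "coeff P [] = 0" "\<And>a. \<exists>c. letter_deriv a P = scale c 1"
  shows "shuffle_primitive P"
  unfolding shuffle_primitive_def
proof (intro conjI allI impI)
  fix a w assume "w \<noteq> ([] :: 'a list)"
  moreover obtain c where "letter_deriv a P = scale c 1" using assms(2) by blast
  then have "coeff (letter_deriv a P) w = coeff (scale c 1) w" by simp
  ultimately show "insertions (coeff P) a w = 0" by simp
qed (rule assms)

lemma shuffle_primitive_add:
  assumes "shuffle_primitive P" "shuffle_primitive Q"
  shows "shuffle_primitive (P + Q)"
proof (rule shuffle_primitiveI)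
  show "\<exists>c. letter_deriv a (P + Q) = scale c 1" for a
    by (rule exI [of _ "coeff P [a] + coeff Q [a]"])
      (auto simp: letter_deriv_linear letter_deriv_primitive assms intro!: ncps_eqI)
qed (use assms in \<open>simp add: shuffle_primitive_def\<close>)

lemma insertions_gen:
  assumes "w \<noteq> []" shows "insertions (coeff (gen b :: ('a, 'k::comm_ring_1) ncps)) a w = 0"
proof -
  have "insertions (coeff (gen b :: ('a, 'k) ncps)) a w = of_nat (Suc (length w)) * 0"
    using assms by (intro insertions_const) (auto simp: append_eq_Cons_conv)
  then show ?thesis by simp
qed

lemma lie_polynomial_primitive:
  "P \<in> lie_polynomials \<Longrightarrow> shuffle_primitive (P :: 'k::comm_ring_1 series)"
proof (induction rule: lie_polynomials.induct)
  case (gen a)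
  then show ?case by (simp add: shuffle_primitive_def insertions_gen)
next
  case zero
  show ?case by (rule shuffle_primitiveI) (auto simp: letter_deriv_linear intro!: exI [of _ 0] ncps_eqI)
next
  case (add P Q)
  then show ?case by (intro shuffle_primitive_add)
next
  case (scale P c)
  show ?case
  proof (rule shuffle_primitiveI)
    show "\<exists>d. letter_deriv a (scale c P) = scale d 1" for a
      by (rule exI [of _ "c * coeff P [a]"])
        (auto simp: letter_deriv_linear letter_deriv_primitive scale intro!: ncps_eqI)
  qed (use scale in \<open>simp add: shuffle_primitive_def\<close>)
qed (rule shuffle_primitive_commutator)

lemma insertions_cong:
  assumes "\<And>v. length v = Suc (length w) \<Longrightarrow> f v = g v"
  shows "insertions f a w = insertions g a w"
  using assms
proof (induction w arbitrary: f g)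
  case (Cons b w)
  have "insertions (\<lambda>v. f (b # v)) a w = insertions (\<lambda>v. g (b # v)) a w"
    by (rule Cons.IH) (rule Cons.prems, simp)
  then show ?case using Cons.prems [of "a # b # w"] by simp
qed simp

text \<open>Each relation involves coefficients of one degree only, so it can be checked on a
  homogeneous part.\<close>

lemma lie_series_primitive:
  assumes "P \<in> lie_series"
  shows "shuffle_primitive (P :: 'k::comm_ring_1 series)"
proof -
  have prim: "shuffle_primitive (homogeneous_part n P)" for n
    using assms by (intro lie_polynomial_primitive) (simp add: lie_series_def)
  have "insertions (coeff P) a w = insertions (coeff (homogeneous_part (Suc (length w)) P)) a w" for a w
    by (rule insertions_cong) simp
  moreover have "coeff P [] = coeff (homogeneous_part 0 P) []" by simp
  ultimately show ?thesis using prim unfolding shuffle_primitive_def by metis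
qed

text \<open>Reversal with the sign \<open>(-1)^length\<close> is an antiautomorphism that negates
  the generators, hence also all brackets.\<close>

lemma lie_polynomial_reverse:
  assumes "P \<in> lie_polynomials"
  shows "coeff (P :: 'k::comm_ring_1 series) (rev w) = (-1) ^ Suc (length w) * coeff P w"
  using assms
proof (induction arbitrary: w)
  case (gen a)
  show ?case by (auto simp: rev_swap)
next
  case (bracket P Q)
  have "coeff (A * B) (rev w) = (-1) ^ length w * coeff (B * A) w"
    if A: "\<And>w. coeff A (rev w) = (-1) ^ Suc (length w) * coeff A w"
      and B: "\<And>w. coeff B (rev w) = (-1) ^ Suc (length w) * coeff B w" for A B :: "'k series"
  proof -
    let ?n = "length w"
    have "coeff (A * B) (rev w) = (\<Sum>i\<le>?n. coeff A (take i (rev w)) * coeff B (drop i (rev w)))"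
      by (simp add: times_ncps_def)
    \<comment> \<open>A cut of the reversed word at \<open>i\<close> is a cut of \<open>w\<close> at
      \<open>?n - i\<close> with the two parts exchanged.\<close>
    also have "\<dots> = (\<Sum>j\<le>?n. coeff A (rev (drop j w)) * coeff B (rev (take j w)))"
      by (rule sum.reindex_bij_witness [where i = "\<lambda>j. ?n - j" and j = "\<lambda>i. ?n - i"])
        (auto simp: take_rev drop_rev)
    also have "\<dots> = (\<Sum>j\<le>?n. (-1) ^ ?n * (coeff B (take j w) * coeff A (drop j w)))"
    proof (rule sum.cong)
      fix j assume "j \<in> {..?n}"
      then have "(-1 :: 'k) ^ ?n = (-1) ^ Suc (length (drop j w)) * (-1) ^ Suc (length (take j w))"
        by (simp add: power_add [symmetric])
      then show "coeff A (rev (drop j w)) * coeff B (rev (take j w))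
          = (-1) ^ ?n * (coeff B (take j w) * coeff A (drop j w))"
        by (simp only: A B mult_ac)
    qed simp
    finally show ?thesis by (simp add: times_ncps_def sum_distrib_left)
  qed
  with bracket.IH show ?case by (simp add: commutator_def algebra_simps)
qed (simp_all add: algebra_simps)

lemma lie_series_reverse:
  assumes "P \<in> lie_series"
  shows "coeff (P :: 'k::comm_ring_1 series) (rev w) = (-1) ^ Suc (length w) * coeff P w"
  using lie_polynomial_reverse [of "homogeneous_part (length w) P" w] assms
  by (simp add: lie_series_def)

text \<open>
  Modulo shuffle products with a letter, every word of length at least two is a combination
  of words that begin with X and end with Y: move trailing X's to the left, then leading
  Y's to the right.
\<close>

lemma shuffle_primitive_eq_0:
  fixes P :: "'k::field_char_0 series"
  assumes prim: "shuffle_primitive P"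
    and XY: "\<And>p. coeff P (X # p @ [Y]) = 0"
    and "length w \<ge> 2"
  shows "coeff P w = 0"
proof -
  have ins: "insertions (coeff P) a w = 0" if "w \<noteq> []" for a w
    using prim that by (simp add: shuffle_primitive_def)
  \<comment> \<open>Shuffling \<open>a\<close> with its power of exponent \<open>m + 1\<close> gives
    \<open>m + 2\<close> times the next power; characteristic 0 allows division.\<close>
  have pure: "coeff P (replicate (Suc (Suc m)) a) = 0" for a m
    using ins [of "replicate (Suc m) a" a] unfolding insertions_replicate
    by (simp del: replicate_Suc of_nat_Suc)
  \<comment> \<open>Shuffle X with \<open>X # p @ Y # replicate k X\<close>. Insertions before that
    Y vanish by induction; the others all give the word with one more trailing X.\<close>
  have trailing: "coeff P (X # p @ Y # replicate k X) = 0" for p k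
  proof (induction k arbitrary: p)
    case (Suc k)
    have "insertions (\<lambda>q. coeff P (q @ Y # replicate k X)) X (X # p) = of_nat (Suc (length (X # p))) * 0"
    proof (rule insertions_const)
      fix u v assume "X # p = u @ v"
      then show "coeff P ((u @ X # v) @ Y # replicate k X) = 0"
        using Suc [of "X # p"] Suc [of "tl u @ X # v"] by (cases u) auto
    qed
    with ins [of "(X # p) @ Y # replicate k X" X]
    have "insertions (\<lambda>q. coeff P ((X # p) @ Y # q)) X (replicate k X) = 0"
      unfolding insertions_append by simp
    then show ?case unfolding insertions_replicate by (simp del: of_nat_Suc)
  qed (simp add: XY)
  have X_first: "coeff P (X # v) = 0" if "v \<noteq> []" for v
  proof (cases "Y \<in> set v")
    case True
    then obtain p q where v: "v = p @ Y # q" "Y \<notin> set q"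
      by (meson split_list_last)
    from v(2) obtain k where "q = replicate k X"
      by (metis letter.exhaust replicate_eqI)
    then show ?thesis using trailing [of p k] v by simp
  next
    case False
    then obtain k where v: "v = replicate k X"
      by (metis letter.exhaust replicate_eqI)
    then obtain m where "k = Suc m" using \<open>v \<noteq> []\<close> by (cases k) auto
    then show ?thesis using pure [of m X] v by simp
  qed
  \<comment> \<open>Shuffle Y with \<open>replicate j Y @ X # v\<close>: insertions after that X
    vanish by induction, the others all give one more leading Y. The side condition excludes the
    one-letter word X.\<close>
  have leading: "coeff P (replicate j Y @ X # v) = 0" if "replicate j Y @ v \<noteq> []" for j v
    using that
  proof (induction j arbitrary: v)
    case (Suc j)
    have "insertions (\<lambda>q. coeff P (replicate j Y @ X # q)) Y v = of_nat (Suc (length v)) * 0"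
      by (rule insertions_const) (simp add: Suc.IH)
    with ins [of "replicate j Y @ X # v" Y]
    have "insertions (\<lambda>q. coeff P (q @ X # v)) Y (replicate j Y) = 0"
      unfolding insertions_append by simp
    then show ?case unfolding insertions_replicate by (simp del: of_nat_Suc)
  qed (simp add: X_first)
  show ?thesis
  proof (cases "X \<in> set w")
    case True
    then obtain p q where w: "w = p @ X # q" "X \<notin> set p"
      by (meson split_list_first)
    from w(2) obtain j where "p = replicate j Y"
      by (metis letter.exhaust replicate_eqI)
    moreover have "replicate j Y @ q \<noteq> []"
      using calculation w \<open>length w \<ge> 2\<close> by auto
    ultimately show ?thesis using leading [of j q] w by simp
  next
    case False
    then obtain j where w: "w = replicate j Y"
      by (metis letter.exhaust replicate_eqI)
    with \<open>length w \<ge> 2\<close> obtain m where "j = 2 + m" using le_Suc_ex [of 2 j] by auto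
    then show ?thesis using pure [of m Y] w by simp
  qed
qed

text \<open>The only other unknown is the coefficient \<open>t\<close> of Y X^m Y. Shuffling Y with
  X^m Y gives \<open>t + m g + g = 0\<close>, and shuffling X with Y X^(m-1) Y gives
  \<open>2 g + m t = 0\<close>, where \<open>g\<close> is \<open>g m\<close>.\<close>

lemma shuffle_primitive_mixed_ends_eq_0:
  fixes P :: "'k::field_char_0 series"
  assumes prim: "shuffle_primitive P"
    and XY: "\<And>p. coeff P (X # p @ [Y]) = g (length p)"
    and YX: "\<And>p. coeff P (Y # p @ [X]) = g (length p)"
    and "m \<ge> 2"
  shows "g m = 0"
proof -
  have ins: "insertions (coeff P) a w = 0" if "w \<noteq> []" for a w
    using prim that by (simp add: shuffle_primitive_def)
  obtain k where m: "m = Suc k" using \<open>m \<ge> 2\<close> by (cases m) auto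
  define t where "t = coeff P (Y # replicate m X @ [Y])"
  have "insertions (\<lambda>p. coeff P (X # p @ [Y])) Y (replicate k X) = of_nat (Suc k) * g m"
  proof -
    have "insertions (\<lambda>p. coeff P (X # p @ [Y])) Y (replicate k X)
        = of_nat (Suc (length (replicate k X))) * g m"
    proof (rule insertions_const)
      fix u v assume "replicate k X = u @ v"
      then have "length (u @ Y # v) = m"
        using m by (metis add_Suc_right length_Cons length_append length_replicate)
      then show "coeff P (X # (u @ Y # v) @ [Y]) = g m" using XY by metis
    qed
    then show ?thesis by simp
  qed
  moreover have "coeff P (replicate m X @ [Y, Y]) = g m"
    using XY [of "replicate k X @ [Y]"] m by simp
  ultimately have "t + of_nat m * g m + g m = 0"
    using ins [of "replicate m X @ [Y]" Y] unfolding insertions_append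
    by (simp add: m t_def)
  moreover have "2 * g m + of_nat m * t = 0"
  proof -
    have "insertions (\<lambda>q. coeff P (Y # q)) X (replicate k X @ [Y]) = of_nat m * t + g m"
      unfolding insertions_append insertions_replicate
      using YX [of "replicate k X @ [Y]"] by (simp add: m t_def)
    moreover have "coeff P (X # Y # replicate k X @ [Y]) = g m"
      using XY [of "Y # replicate k X"] m by simp
    ultimately show ?thesis
      using ins [of "Y # replicate k X @ [Y]" X] by simp
  qed
  \<comment> \<open>Elimination of \<open>t\<close>. The remaining factor is nonzero because
    \<open>m * Suc m\<close> is at least 6.\<close>
  moreover have "g m * (2 - of_nat (m * Suc m))
      = (2 * g m + of_nat m * t) - of_nat m * (t + of_nat m * g m + g m)"
    by (simp add: algebra_simps)
  ultimately have "g m * (2 - of_nat (m * Suc m)) = 0" by simp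
  moreover have "m * Suc m \<noteq> 2"
    using \<open>m \<ge> 2\<close> mult_le_mono [of 2 m 3 "Suc m"] by linarith
  then have "of_nat (m * Suc m) \<noteq> (2 :: 'k)"
    by (metis of_nat_eq_iff of_nat_numeral)
  ultimately show ?thesis by simp
qed


section \<open>The harmonic antipode on words in X and Y\<close>

lemma word_of_yword_simps [simp]:
  "word_of_yword [] = []"
  "word_of_yword (k # u) = replicate k X @ Y # word_of_yword u"
  "word_of_yword (u @ v) = word_of_yword u @ word_of_yword v"
  by (simp_all add: word_of_yword_def)

lemma length_word_of_yword [simp]: "length (word_of_yword u) = weight u"
  by (induction u) simp_all

lemma word_of_yword_eq_Nil [simp]: "word_of_yword u = [] \<longleftrightarrow> u = []"
  by (cases u) simp_all

text \<open>The counter \<open>k\<close> holds the number of X read since the last Y. Trailing X are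
  dropped, so this inverts \<open>word_of_yword\<close> only on the empty word and words ending in
  Y.\<close>

fun yword_of_word :: "nat \<Rightarrow> letter list \<Rightarrow> yword" where
  "yword_of_word k [] = []"
| "yword_of_word k (X # p) = yword_of_word (Suc k) p"
| "yword_of_word k (Y # p) = k # yword_of_word 0 p"

lemma yword_of_word_of_yword [simp]: "yword_of_word 0 (word_of_yword u) = u"
proof -
  have "yword_of_word j (replicate k X @ Y # p) = (j + k) # yword_of_word 0 p" for j k p
    by (induction k arbitrary: j) simp_all
  then show ?thesis by (induction u) simp_all
qed

lemma word_of_yword_inject [simp]: "word_of_yword u = word_of_yword v \<longleftrightarrow> u = v"
  by (metis yword_of_word_of_yword)

lemma ex_word_of_yword: "\<exists>v. word_of_yword v = p @ [Y]"
proof (induction p)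
  case Nil
  show ?case by (rule exI [of _ "[0]"]) simp
next
  case (Cons a p)
  then obtain v where v: "word_of_yword v = p @ [Y]" by blast
  show ?case
  proof (cases a)
    case X
    obtain k u where "v = k # u" using v by (cases v) auto
    then show ?thesis using v X by (intro exI [of _ "Suc k # u"]) simp
  next
    case Y
    then show ?thesis using v by (intro exI [of _ "0 # v"]) simp
  qed
qed

lemma word_of_yword_snoc:
  assumes "v \<noteq> []"
  obtains p where "word_of_yword v = p @ [Y]"
  using assms by (cases v rule: rev_cases) simp_all

text \<open>Letterwise reversal turns each block X^k Y into Y X^k; moving one Y from the end to the
  front restores the blocks, in reversed order.\<close>

lemma word_of_yword_rev: "Y # word_of_yword (rev v) = rev (word_of_yword v) @ [Y]"
proof (induction v)
  case (Cons k v)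
  have "Y # word_of_yword (rev (k # v)) = (Y # word_of_yword (rev v)) @ replicate k X @ [Y]" by simp
  then show ?case unfolding Cons by simp
qed simp

lemma length_eq_count_Y: "length v = count_list (word_of_yword v) Y"
proof -
  have "count_list (replicate k X) Y = 0" for k by (induction k) simp_all
  then show ?thesis by (induction v) simp_all
qed

section \<open>Coefficients of the antipode\<close>

lemma lookup_yword_mult:
  fixes p q :: "'k::comm_ring_1 ypoly"
  shows "Poly_Mapping.lookup (p * q) w
    = (\<Sum>i\<le>length w. Poly_Mapping.lookup p (take i w) * Poly_Mapping.lookup q (drop i w))"
proof (induction p rule: poly_induct)
  case (single u c)
  show ?case
  proof (induction q rule: poly_induct)
    case (single v d)
    have iff: "u = take i w \<and> v = drop i w \<longleftrightarrow> i = length u \<and> u @ v = w" if "i \<le> length w" for i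
      using that by (metis append_eq_conv_conj append_take_drop_id length_take min.absorb2)
    have "Poly_Mapping.lookup (Poly_Mapping.single u c) (take i w)
        * Poly_Mapping.lookup (Poly_Mapping.single v d) (drop i w)
      = (if i = length u then if u @ v = w then c * d else 0 else 0)" if "i \<le> length w" for i
      using iff [OF that]
      by (cases "u = take i w \<and> v = drop i w") (auto simp: lookup_single when_def)
    then have "(\<Sum>i\<le>length w. Poly_Mapping.lookup (Poly_Mapping.single u c) (take i w)
        * Poly_Mapping.lookup (Poly_Mapping.single v d) (drop i w))
      = (\<Sum>i\<le>length w. if i = length u then if u @ v = w then c * d else 0 else 0)"
      by (intro sum.cong) simp_all
    then show ?case by (auto simp: mult_single lookup_single plus_list_def when_def)
  qed (simp add: distrib_left lookup_add sum.distrib)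
qed (simp add: distrib_right lookup_add sum.distrib)

lemma lookup_letter_mult:
  fixes q :: "'k::comm_ring_1 ypoly"
  shows "Poly_Mapping.lookup (monomial [i] * q) w
    = (case w of [] \<Rightarrow> 0 | j # v \<Rightarrow> if i = j then Poly_Mapping.lookup q v else 0)"
  by (induction q rule: poly_induct)
    (auto simp: mult_single lookup_single plus_list_def when_def distrib_left lookup_add split: list.split)

lemma weight_eq_0 [simp]: "weight u = 0 \<longleftrightarrow> u = []"
  by (cases u) simp_all

text \<open>The inverse of 1 - sum Y_m is the sum of all words, so Y_m goes to minus the sum of the
  words of weight m, that is to -(x+y)^(m-1) y.\<close>

lemma lookup_antipode_letter:
  "Poly_Mapping.lookup (antipode_letter k :: 'k::comm_ring_1 ypoly) w = (if weight w = Suc k then -1 else 0)"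
proof (induction k arbitrary: w rule: less_induct)
  case (less k)
  show ?case
  proof (cases w)
    case Nil
    then show ?thesis
      by (subst antipode_letter_right) (simp add: lookup_minus lookup_sum lookup_letter_mult lookup_single)
  next
    case (Cons j v)
    have "Poly_Mapping.lookup (antipode_letter k :: 'k ypoly) w
        = (if w = [k] then -1 else 0)
          + (\<Sum>i<k. if i = j then if weight v = k - i then -1 else 0 else 0)"
      using less
      by (subst antipode_letter_right)
        (auto simp: lookup_minus lookup_sum lookup_letter_mult lookup_single when_def Cons Suc_diff_Suc
          intro!: sum.cong)
    then show ?thesis by (auto simp: Cons)
  qed
qed

text \<open>
  The words occurring in the image of a word under \<open>x \<mapsto> x + y\<close>, \<open>y \<mapsto> - y\<close> are those with a Y
  at every position where the given word has one.
\<close>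

abbreviation refines :: "letter list \<Rightarrow> letter list \<Rightarrow> bool"
  where "refines \<equiv> list_all2 (\<lambda>a b. a = Y \<longrightarrow> b = Y)"

lemma refines_letter: "refines (replicate k X @ [Y]) (word_of_yword w) \<longleftrightarrow> weight w = Suc k"
proof
  assume "weight w = Suc k"
  then obtain p where p: "word_of_yword w = p @ [Y]" by (cases "w = []") (auto elim: word_of_yword_snoc)
  from arg_cong [OF this, of length] have "length p = k" using \<open>weight w = Suc k\<close> by simp
  then show "refines (replicate k X @ [Y]) (word_of_yword w)"
    by (auto simp: p list_all2_conv_all_nth nth_append)
qed (auto dest: list_all2_lengthD)

text \<open>The antipode reverses products, so \<open>w\<close> must split into pieces with the
  weights of the letters of \<open>rev v\<close>. Such a splitting is unique if it exists, and each
  letter contributes a sign.\<close>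

lemma lookup_antipode_word:
  "Poly_Mapping.lookup (antipode_word v :: 'k::comm_ring_1 ypoly) w
    = (if refines (word_of_yword (rev v)) (word_of_yword w) then (-1) ^ length v else 0)"
proof (induction v arbitrary: w)
  case Nil
  then show ?case by (auto simp: lookup_one zero_list_def when_def)
next
  case (Cons k u)
  let ?f = "\<lambda>i. Poly_Mapping.lookup (antipode_word u :: 'k ypoly) (take i w)
      * Poly_Mapping.lookup (antipode_letter k) (drop i w)"
  have sum: "Poly_Mapping.lookup (antipode_word (k # u) :: 'k ypoly) w = (\<Sum>i\<le>length w. ?f i)"
    by (simp add: lookup_yword_mult)
  show ?case
  proof (cases "refines (word_of_yword (rev (k # u))) (word_of_yword w)")
    case True
    then obtain p q where pq: "word_of_yword w = p @ q"
      "refines (word_of_yword (rev u)) p" "refines (replicate k X @ [Y]) q"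
      by (auto simp: list_all2_append1)
    \<comment> \<open>Refinement keeps the final Y of a block, so the cut of the X, Y word falls
      between two letters of \<open>w\<close>.\<close>
    have "p = [] \<or> (\<exists>p'. p = p' @ [Y])"
    proof (cases "u = []")
      case True
      then show ?thesis using pq(2) by simp
    next
      case False
      then have "rev u \<noteq> []" by simp
      then obtain r where "word_of_yword (rev u) = r @ [Y]" by (rule word_of_yword_snoc)
      then show ?thesis using pq(2) by (auto simp: list_all2_append1 list_all2_Cons1)
    qed
    then obtain w1 where w1: "word_of_yword w1 = p"
      using ex_word_of_yword word_of_yword_simps(1) by metis
    have "\<exists>q'. q = q' @ [Y]"
      using pq(3) by (auto simp: list_all2_append1 list_all2_Cons1)
    then obtain w2 where w2: "word_of_yword w2 = q" using ex_word_of_yword by metis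
    have "word_of_yword w = word_of_yword (w1 @ w2)" using pq(1) w1 w2 by simp
    then have w: "w = w1 @ w2" by (simp only: word_of_yword_inject)
    have wt: "weight w2 = Suc k" using pq(3) w2 by (simp add: refines_letter [symmetric])
    \<comment> \<open>Letters have positive weight, so no other suffix of \<open>w\<close> has
      weight \<open>Suc k\<close>.\<close>
    have "i = length w1" if "i \<le> length w" "weight (drop i w) = Suc k" for i
    proof (rule ccontr)
      assume "i \<noteq> length w1"
      then consider "i < length w1" | "i > length w1" by linarith
      then show False
      proof cases
        case 1
        then show False using that(2) w wt by simp
      next
        case 2
        then have "w2 = take (i - length w1) w2 @ drop i w" "take (i - length w1) w2 \<noteq> []"
          using that(1) w by auto
        then show False using that(2) wt weight_simps(3) [of "take (i - length w1) w2" "drop i w"] by auto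
      qed
    qed
    then have "(\<Sum>i\<le>length w. ?f i) = (\<Sum>i\<in>{length w1}. ?f i)"
      by (intro sum.mono_neutral_right) (auto simp: w lookup_antipode_letter)
    also have "\<dots> = (-1) ^ length (k # u)"
      using pq w1 w2 wt by (simp add: w lookup_antipode_letter Cons)
    finally show ?thesis using True sum by simp
  next
    case False
    have "?f i = 0" for i
    proof (rule ccontr)
      assume "?f i \<noteq> 0"
      then have "refines (word_of_yword (rev u)) (word_of_yword (take i w))"
        "refines (replicate k X @ [Y]) (word_of_yword (drop i w))"
        by (auto simp: Cons lookup_antipode_letter refines_letter split: if_splits)
      moreover have "word_of_yword w = word_of_yword (take i w) @ word_of_yword (drop i w)"
        by (simp flip: word_of_yword_simps(3))
      ultimately show False
        using False list_all2_appendI by fastforce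
    qed
    then show ?thesis using False sum by simp
  qed
qed

text \<open>Each X becomes X or Y with the sign -1, while each Y stays.\<close>

lemma coeff_word_val_refines:
  "coeff (prod_list (map (letter_val (- gen X - gen Y) (gen Y)) v)) w
    = (if refines v w then (-1) ^ count_list v X else (0 :: 'k::comm_ring_1))"
proof (induction v arbitrary: w)
  case (Cons a v)
  have lin: "linear_form (letter_val (- gen X - gen Y) (gen Y :: 'k series) a)"
    by (simp add: linear_form_letter_val)
  show ?case
  proof (cases w)
    case Nil
    then show ?thesis using lin by simp
  next
    case (Cons b u)
    then show ?thesis
      using Cons.IH [of u] lin
      by (cases a; cases b) (simp_all add: coeff_linear_form_times_Cons)
  qed
qed auto

lemma count_letters: "count_list v X + count_list v Y = length v"
proof (induction v)
  case (Cons a v)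
  then show ?case by (cases a) simp_all
qed simp

text \<open>
  That is, \<open>R\<^sub>y y\<close> is mapped to \<open>- \<sigma>(R\<^sub>y) y\<close> for the antiautomorphism \<open>\<sigma>\<close> with
  \<open>x \<mapsto> x + y\<close>, \<open>y \<mapsto> - y\<close>, written as the signed reversal of words followed by a substitution.
\<close>

lemma coeff_harmonic_antipode:
  fixes R :: "'k::comm_ring_1 series"
  assumes w: "word_of_yword w = q @ [Y]"
  shows "coeff (harmonic_antipode (to_yseries R)) w
    = - coeff (subst (NCPS (\<lambda>p. (-1) ^ length p * coeff R (rev p @ [Y]))) (- gen X - gen Y) (gen Y)) q"
proof -
  \<comment> \<open>Here \<open>p\<close> is the X, Y word of \<open>v\<close> without its final Y;
    that Y accounts for the minus sign.\<close>
  let ?g = "\<lambda>p. coeff R (p @ [Y]) * (if refines (rev p) q then - ((-1) ^ count_list p Y) else 0)"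
  have wt: "weight w = Suc (length q)"
    using arg_cong [OF w, of length] by simp
  have "coeff (harmonic_antipode (to_yseries R)) w
      = (\<Sum>v | weight v = weight w. coeff R (word_of_yword v)
          * (if refines (word_of_yword (rev v)) (word_of_yword w) then (-1) ^ length v else 0))"
    by (simp add: harmonic_antipode_def to_yseries_def harmonic_antipode_poly_monomial lookup_antipode_word)
  also have "\<dots> = (\<Sum>p | length p = length q. ?g p)"
  proof (rule sum.reindex_bij_witness [where i = "\<lambda>p. yword_of_word 0 (p @ [Y])"
          and j = "\<lambda>v. butlast (word_of_yword v)"])
    fix v assume "v \<in> {v. weight v = weight w}"
    then have v: "weight v = Suc (length q)" using wt by simp
    then obtain p where p: "word_of_yword v = p @ [Y]"
      by (cases "v = []") (auto elim: word_of_yword_snoc)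
    have [simp]: "length p = length q" using arg_cong [OF p, of length] v by simp
    have rev: "word_of_yword (rev v) = rev p @ [Y]" using word_of_yword_rev [of v] p by simp
    show "yword_of_word 0 (butlast (word_of_yword v) @ [Y]) = v"
      using yword_of_word_of_yword [of v] p by simp
    show "butlast (word_of_yword v) \<in> {p. length p = length q}" using p by simp
    show "?g (butlast (word_of_yword v)) = coeff R (word_of_yword v)
        * (if refines (word_of_yword (rev v)) (word_of_yword w) then (-1) ^ length v else 0)"
      using length_eq_count_Y [of v] by (simp add: p rev w list_all2_append)
  next
    fix p assume "p \<in> {p :: letter list. length p = length q}"
    then have "length p = length q" by simp
    obtain v where v: "word_of_yword v = p @ [Y]" using ex_word_of_yword by blast
    then have v': "yword_of_word 0 (p @ [Y]) = v" using yword_of_word_of_yword [of v] by simp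
    show "butlast (word_of_yword (yword_of_word 0 (p @ [Y]))) = p" by (simp add: v v')
    have "weight v = length (p @ [Y])" by (simp flip: v)
    then show "yword_of_word 0 (p @ [Y]) \<in> {v. weight v = weight w}"
      using \<open>length p = length q\<close> by (simp add: v' wt)
  qed
  also have "\<dots> = (\<Sum>p | length p = length q. ?g (rev p))"
    by (rule sum.reindex_bij_witness [where i = rev and j = rev]) auto
  also have "\<dots> = (\<Sum>p | length p = length q. - ((-1) ^ length p * coeff R (rev p @ [Y])
      * (if refines p q then (-1) ^ count_list p X else 0)))"
  proof (rule sum.cong)
    fix p :: "letter list"
    \<comment> \<open>The sign counting Y is split between the signed reversal, by length, and the
      substitution, by the X.\<close>
    have sign: "(-1 :: 'k) ^ length p * (-1) ^ count_list p X = (-1) ^ count_list p Y"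
      by (simp flip: count_letters add: power_add mult_ac power_mult_distrib [symmetric])
    show "?g (rev p) = - ((-1) ^ length p * coeff R (rev p @ [Y])
      * (if refines p q then (-1) ^ count_list p X else 0))"
      by (simp add: sign [symmetric] mult_ac)
  qed simp
  also have "\<dots> = - coeff (subst (NCPS (\<lambda>p. (-1) ^ length p * coeff R (rev p @ [Y])))
      (- gen X - gen Y) (gen Y)) q"
    by (simp add: coeff_subst_linear coeff_word_val_refines sum_negf)
  finally show ?thesis .
qed

lemma coeff_harmonic_antipode_Nil:
  "coeff (harmonic_antipode (P :: 'k::comm_ring_1 yseries)) [] = coeff P []"
  by (simp add: harmonic_antipode_def harmonic_antipode_poly_monomial lookup_one zero_list_def)


section \<open>The equivalence\<close>

text \<open>The Q' of the overview: it fixes y and exchanges x with z = -x-y.\<close>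

abbreviation flip_x :: "'k::comm_ring_1 series \<Rightarrow> 'k series"
  where "flip_x P \<equiv> subst P (- gen X - gen Y) (gen Y)"

text \<open>A change of free generators: \<open>flip_y P\<close> is the expression of
  \<open>P\<close> in x and z, with the letter Y standing for z.\<close>

abbreviation flip_y :: "'k::comm_ring_1 series \<Rightarrow> 'k series"
  where "flip_y P \<equiv> subst P (gen X) (- gen X - gen Y)"

lemma flip_x_flip_x: "flip_x (flip_x P) = P"
  by (simp add: subst_subst subst_diff subst_minus subst_gen subst_gens)

lemma flip_y_flip_y: "flip_y (flip_y P) = P"
  by (simp add: subst_subst subst_diff subst_minus subst_gen subst_gens)

section \<open>Series in y alone and the antipode condition\<close>

definition y_series :: "'k::zero series \<Rightarrow> bool"
  where "y_series G \<longleftrightarrow> (\<forall>q. X \<in> set q \<longrightarrow> coeff G q = 0)"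

lemma y_series_left_factor:
  assumes "y_series G"
  shows "left_factor X G = (0 :: 'k::comm_ring_1 series)" "y_series (left_factor Y G)"
  using assms by (auto simp: y_series_def intro: ncps_eqI)

lemma flip_x_y_series:
  assumes "y_series G"
  shows "flip_x G = G"
proof (rule ncps_eqI)
  fix q
  show "coeff (flip_x G) q = coeff G q"
    using assms
  proof (induction q arbitrary: G)
    case (Cons a q)
    note G = y_series_left_factor [OF Cons.prems]
    have "left_factor X G = 0" "coeff (flip_x (left_factor Y G)) q = coeff (left_factor Y G) q"
      using G Cons.IH by blast+
    then show ?case
      using Cons.prems by (cases a) (simp_all add: coeff_subst_Cons subst_zero y_series_def)
  qed simp
qed

text \<open>In the generators x and z, y^m is (-1)^m (x+z)^m, so all words of one length have the
  same coefficient.\<close>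

lemma coeff_flip_y_y_series:
  assumes "y_series G"
  shows "coeff (flip_y G) p = (-1) ^ length p * coeff G (replicate (length p) Y)"
  using assms
proof (induction p arbitrary: G)
  case (Cons a p)
  note G = y_series_left_factor [OF Cons.prems]
  have "coeff (flip_y (left_factor Y G)) p = (-1) ^ length p * coeff G (Y # replicate (length p) Y)"
    using Cons.IH [OF G(2)] by simp
  then show ?case using G(1) by (cases a) (simp_all add: coeff_subst_Cons subst_zero)
qed simp

lemma eq_replicate_Y_iff: "q = replicate (length q) Y \<longleftrightarrow> X \<notin> set q"
  by (metis in_set_replicate letter.distinct(1) letter.exhaust replicate_eqI)

text \<open>Lie reversal sends psi_y to psi^y, so at q y the antipode yields -(psi^y)' minus the
  signed correction. Comparing this with -psi_y minus the correction gives the right-hand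
  side.\<close>

lemma antipode_condition_iff:
  fixes \<psi> :: "'k::field_char_0 series"
  assumes lie: "\<psi> \<in> lie_series"
  shows "harmonic_antipode (regularization \<psi>) = - regularization \<psi> \<longleftrightarrow>
    (\<forall>q. coeff (right_factor Y \<psi> - flip_x (left_factor Y \<psi>)) q
      = (if X \<in> set q then 0
         else ((-1) ^ length q - 1) * (coeff \<psi> (replicate (length q) X @ [Y]) / of_nat (Suc (length q)))))"
    (is "_ \<longleftrightarrow> (\<forall>q. ?lhs q = ?rhs q)")
proof -
  define R where "R = pi_Y \<psi> + regularization_correction \<psi>"
  define g where "g q = (if X \<in> set q then 0
      else coeff \<psi> (replicate (length q) X @ [Y]) / of_nat (Suc (length q)))" for q :: "letter list"
  \<comment> \<open>The regularization correction \<open>g\<close> after signed reversal; as a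
    series in y it is fixed by \<open>flip_x\<close>.\<close>
  define G where "G = NCPS (\<lambda>p. (-1) ^ length p * g p)"
  have psi0: "coeff \<psi> [] = 0"
    using lie_series_primitive [OF lie] by (simp add: shuffle_primitive_def)
  have "q @ [Y] = replicate (Suc (length q)) Y \<longleftrightarrow> q = replicate (length q) Y" for q
    by (simp add: replicate_append_same [symmetric])
  then have R: "coeff R (q @ [Y]) = coeff \<psi> (q @ [Y]) + g q" for q
    by (simp add: R_def pi_Y_def regularization_correction_def g_def eq_replicate_Y_iff Let_def
        del: replicate_Suc)
  have "NCPS (\<lambda>p. (-1) ^ length p * coeff R (rev p @ [Y])) = left_factor Y \<psi> + G"
  proof (rule ncps_eqI)
    fix p
    have "coeff \<psi> (Y # p) = (-1) ^ length p * coeff \<psi> (rev p @ [Y])"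
      using lie_series_reverse [OF lie, of "rev p @ [Y]"] by simp
    then show "coeff (NCPS (\<lambda>p. (-1) ^ length p * coeff R (rev p @ [Y]))) p = coeff (left_factor Y \<psi> + G) p"
      by (simp add: R G_def g_def distrib_left)
  qed
  moreover have "y_series G" by (simp add: y_series_def G_def g_def)
  ultimately have S: "coeff (harmonic_antipode (regularization \<psi>)) w
      = - (coeff (flip_x (left_factor Y \<psi>)) q + coeff G q)"
    if "word_of_yword w = q @ [Y]" for w q
    using coeff_harmonic_antipode [OF that, of R]
    by (simp add: regularization_def R_def [symmetric] subst_add flip_x_y_series)
  have "coeff (harmonic_antipode (regularization \<psi>)) w = coeff (- regularization \<psi>) w \<longleftrightarrow> ?lhs q = ?rhs q"
    if w: "word_of_yword w = q @ [Y]" for w q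
  proof -
    have reg: "coeff (- regularization \<psi>) w = - (coeff \<psi> (q @ [Y]) + g q)"
      by (simp add: regularization_def R_def [symmetric] to_yseries_def w R)
    have rhs: "?rhs q = coeff G q - g q"
      by (simp add: G_def g_def left_diff_distrib diff_divide_distrib)
    have lhs: "?lhs q = coeff \<psi> (q @ [Y]) - coeff (flip_x (left_factor Y \<psi>)) q"
      by simp
    have "- (f + h) = - (p + r) \<longleftrightarrow> p - f = h - r" for f h p r :: 'k
      by (auto simp: algebra_simps)
    then show ?thesis unfolding S [OF w] reg lhs rhs by blast
  qed
  moreover have "coeff (harmonic_antipode (regularization \<psi>)) [] = coeff (- regularization \<psi>) []"
    by (simp add: coeff_harmonic_antipode_Nil regularization_def to_yseries_def pi_Y_def const_term_def
        regularization_correction_def psi0 Let_def)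
  ultimately have "(\<forall>w. coeff (harmonic_antipode (regularization \<psi>)) w = coeff (- regularization \<psi>) w)
      \<longleftrightarrow> (\<forall>q. ?lhs q = ?rhs q)"
    by (metis ex_word_of_yword word_of_yword_snoc)
  then show ?thesis by (metis ncps_eqI)
qed

section \<open>The commutator condition in the generators x and z\<close>

lemma commutator_identity:
  fixes x y z :: "'r::ring"
  assumes z: "z = - x - y"
    and p: "p = x * c + y * d" "p = a * x + b * y"
    and q: "q = z * c' + y * d'" "q = a' * z + b' * y"
  shows "commutator p x + commutator q z
    = x * (c - d - a + b) * x + z * (c' - d' - a' + b') * z + x * (b - d') * z + z * (b' - d) * x"
proof -
  have y: "y = - x - z" using z by simp
  \<comment> \<open>Using the left decomposition in \<open>p * x\<close> and the right one in
    \<open>x * p\<close>, and then y = -x-z, makes every term begin and end with x or z.\<close>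
  have "commutator p x + commutator q z
      = (x * c + y * d) * x - x * (a * x + b * y) + ((z * c' + y * d') * z - z * (a' * z + b' * y))"
    unfolding commutator_def using p q by metis
  then show ?thesis unfolding y by (simp add: algebra_simps)
qed

lemma flip_y_commutators:
  fixes \<psi> :: "'k::comm_ring_1 series"
  assumes "coeff \<psi> [] = 0"
  defines "A \<equiv> left_factor X \<psi> - left_factor Y \<psi> - right_factor X \<psi> + right_factor Y \<psi>"
    and "G \<equiv> right_factor Y \<psi> - flip_x (left_factor Y \<psi>)"
  shows "flip_y (commutator \<psi> (gen X) + commutator (flip_x \<psi>) (- gen X - gen Y))
    = gen X * flip_y A * gen X + gen Y * flip_y (flip_x A) * gen Y
      + gen X * flip_y G * gen Y + gen Y * flip_y (flip_x G) * gen X"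
proof -
  let ?z = "- gen X - gen Y :: 'k series"
  \<comment> \<open>The decompositions of \<open>\<psi>\<close> become those of
    \<open>flip_x \<psi>\<close>, with \<open>?z\<close> in place of x.\<close>
  have flip: "flip_x (P * gen X + Q * gen Y) = flip_x P * ?z + flip_x Q * gen Y"
    "flip_x (gen X * P + gen Y * Q) = ?z * flip_x P + gen Y * flip_x Q" for P Q
    by (simp_all add: subst_add subst_times subst_gen)
  note left = left_decomposition [OF assms(1)] and right = right_decomposition [OF assms(1)]
  have "commutator \<psi> (gen X) + commutator (flip_x \<psi>) ?z
      = gen X * A * gen X
        + ?z * (flip_x (left_factor X \<psi>) - flip_x (left_factor Y \<psi>)
                - flip_x (right_factor X \<psi>) + flip_x (right_factor Y \<psi>)) * ?z
        + gen X * G * ?z + ?z * (flip_x (right_factor Y \<psi>) - left_factor Y \<psi>) * gen X"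
    unfolding A_def G_def
    by (rule commutator_identity [OF refl left right
          arg_cong [OF left, of flip_x, unfolded flip] arg_cong [OF right, of flip_x, unfolded flip]])
  \<comment> \<open>The last middle factor is \<open>flip_x G\<close> because \<open>flip_x\<close>
    is an involution.\<close>
  also have "\<dots> = gen X * A * gen X + ?z * flip_x A * ?z + gen X * G * ?z + ?z * flip_x G * gen X"
    by (simp add: A_def G_def subst_diff subst_add flip_x_flip_x)
  finally show ?thesis
    by (simp add: subst_add subst_diff subst_minus subst_times subst_gen)
qed

theorem theorem1p2:
  fixes \<psi> :: "('k::field_char_0) series"
  assumes "\<psi> \<in> lie_series_ge 3"
  shows "harmonic_antipode (regularization \<psi>) = - regularization \<psi> \<longleftrightarrow>
    commutator \<psi> (gen X) + commutator (subst \<psi> (- gen X - gen Y) (gen Y)) (- gen X - gen Y) = 0"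
    (is "_ \<longleftrightarrow> ?E = 0")
proof -
  have lie: "\<psi> \<in> lie_series" and low: "\<And>w. length w < 3 \<Longrightarrow> coeff \<psi> w = 0"
    using assms by (auto simp: lie_series_ge_def)
  define A where "A = left_factor X \<psi> - left_factor Y \<psi> - right_factor X \<psi> + right_factor Y \<psi>"
  define G where "G = right_factor Y \<psi> - flip_x (left_factor Y \<psi>)"
  define T where "T = flip_y ?E"
  have T: "T = gen X * flip_y A * gen X + gen Y * flip_y (flip_x A) * gen Y
      + gen X * flip_y G * gen Y + gen Y * flip_y (flip_x G) * gen X"
    unfolding T_def A_def G_def by (rule flip_y_commutators) (simp add: low)
  have T_coeff: "coeff T (X # p @ [Y]) = coeff (flip_y G) p"
    "coeff T (Y # p @ [X]) = coeff (flip_y (flip_x G)) p"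
    "coeff T (X # p @ [X]) = coeff (flip_y A) p" for p
    by (simp_all add: T coeff_two_sided)
  have E_iff: "?E = 0 \<longleftrightarrow> T = 0"
    unfolding T_def by (metis flip_y_flip_y linear_form_closed subst_zero)
  have cond: "harmonic_antipode (regularization \<psi>) = - regularization \<psi> \<longleftrightarrow>
    (\<forall>q. coeff G q = (if X \<in> set q then 0
         else ((-1) ^ length q - 1) * (coeff \<psi> (replicate (length q) X @ [Y]) / of_nat (Suc (length q)))))"
    unfolding G_def by (rule antipode_condition_iff [OF lie])
  show ?thesis
    unfolding E_iff
  proof
    assume "harmonic_antipode (regularization \<psi>) = - regularization \<psi>"
    then have G: "coeff G q = (if X \<in> set q then 0
         else ((-1) ^ length q - 1) * (coeff \<psi> (replicate (length q) X @ [Y]) / of_nat (Suc (length q))))" for q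
      using cond by blast
    then have y: "y_series G" by (simp add: y_series_def)
    \<comment> \<open>This is g_m of the overview, the common coefficient of words of length
      \<open>m\<close> in x and z; the sign comes from y = -x-z.\<close>
    define g where "g m = (-1) ^ m * coeff G (replicate m Y)" for m
    have ends: "coeff T (X # p @ [Y]) = g (length p)" "coeff T (Y # p @ [X]) = g (length p)" for p
      by (simp_all add: T_coeff flip_x_y_series y coeff_flip_y_y_series g_def)
    \<comment> \<open>As a sum of brackets of Lie series, \<open>T\<close> satisfies the shuffle
      relations.\<close>
    have "T = commutator (flip_y \<psi>) (gen X) + commutator (flip_y (flip_x \<psi>)) (gen Y)"
      by (simp add: T_def commutator_def subst_add subst_diff subst_minus subst_times subst_gen)
    moreover have "flip_y \<psi> \<in> lie_series" "flip_y (flip_x \<psi>) \<in> lie_series"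
      by (simp_all add: lie subst_lie_series gens_lie_polynomials lie_polynomials.gen)
    ultimately have prim: "shuffle_primitive T"
      by (simp add: lie_series_primitive shuffle_primitive_add shuffle_primitive_commutator
          lie_polynomial_primitive lie_polynomials.gen)
    have "g m = 0" for m
    proof (cases "m \<ge> 2")
      case True
      with shuffle_primitive_mixed_ends_eq_0 [where g = g, OF prim ends] show ?thesis by blast
    next
      case False
      \<comment> \<open>For \<open>m < 2\<close>, \<open>g m\<close> involves a coefficient of
        \<open>\<psi>\<close> in degree \<open>m + 1\<close>, below 3.\<close>
      then show ?thesis by (simp add: g_def G low)
    qed
    then have long: "coeff T w = 0" if "length w \<ge> 2" for w
      using shuffle_primitive_eq_0 [OF prim _ that] ends(1) by simp
    show "T = 0"
    proof (rule ncps_eqI)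
      fix w
      show "coeff T w = coeff 0 w"
      proof (cases "length w \<ge> 2")
        \<comment> \<open>The two outer letters of each term of \<open>T\<close> leave nothing in
          degrees 0 and 1.\<close>
        case False
        then consider "w = []" | a where "w = [a]" by (cases w; cases "tl w") auto
        then show ?thesis
          by cases (simp_all add: T coeff_times_Cons coeff_linear_form_times_Cons)
      qed (simp add: long)
    qed
  next
    assume "T = 0"
    then have "flip_y G = 0" "flip_y A = 0"
      using T_coeff by (auto intro!: ncps_eqI)
    then have "G = 0" "A = 0"
      by (metis flip_y_flip_y linear_form_closed subst_zero)+
    have "((-1) ^ m - 1) * coeff \<psi> (replicate m X @ [Y]) = 0" for m
    proof -
      \<comment> \<open>The two coefficients of \<open>\<psi>\<close> at the pure power of X cancel
        in \<open>A\<close>, leaving those at Y X^m and X^m Y; reversal relates these by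
        \<open>(-1)^m\<close>.\<close>
      have "coeff A (replicate m X) = 0" using \<open>A = 0\<close> by simp
      then have "coeff \<psi> (Y # replicate m X) = coeff \<psi> (replicate m X @ [Y])"
        by (simp add: A_def replicate_append_same)
      moreover have "coeff \<psi> (Y # replicate m X) = (-1) ^ m * coeff \<psi> (replicate m X @ [Y])"
        using lie_series_reverse [OF lie, of "replicate m X @ [Y]"] by simp
      ultimately show ?thesis by (simp add: algebra_simps)
    qed
    then show "harmonic_antipode (regularization \<psi>) = - regularization \<psi>"
      using cond \<open>G = 0\<close> by simp
  qed
qed

end
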